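(* Let $(k_1,\ldots,k_n)$ be an admissible index and $(k'_1,\ldots,k'_{n'})$ its dual index. Then for every integer $l\ge 0$ and every complex number $\alpha$ with $\mathrm{Re}\,\alpha>0$, \[ \sum_{\substack{l_1+\cdots+l_n=l\\ l_i\in\mathbb{Z}_{\ge0}}} Z(k_1+l_1,\ldots,k_n+l_n;\alpha)=\sum_{\substack{l_1+\cdots+l_{n'}=l\\ l_i\in\mathbb{Z}_{\ge0}}} Z(k'_1+l_1,\ldots,k'_{n'}+l_{n'};\alpha). \]
   Context: An index $(k_1,\ldots,k_n)$ is admissible if all $k_i$ are positive integers and $k_n\ge2$. For $a\in\mathbb{C}$, $(a)_0=1$ and $(a)_m=a(a+1)\cdots(a+m-1)$ for $m\ge1$. For an admissible index $\mathbf{k}=(k_1,\ldots,k_n)$, $\alpha,\beta\in\mathbb{C}$ with $\mathrm{Re}\,\alpha>0$, $\beta\notin\mathbb{Z}_{\le0}$, define \[ Z(k_1,\ldots,k_n;\alpha,\beta)=\sum_{0\le m_1<\cdots<m_n}\frac{(\alpha)_{m_1}}{m_1!}\frac{m_n!}{(\alpha)_{m_n+1}}\frac{1}{(m_1+\beta)^{k_1}\cdots(m_{n-1}+\beta)^{k_{n-1}}(m_n+\beta)^{k_n-1}}, \] and $Z(\mathbf{k};\alpha):=Z(\mathbf{k};\alpha,\alpha)$. Every admissible index can be written uniquely as $(\{1\}^{a_1},b_1+2,\ldots,\{1\}^{a_s},b_s+2)$ with $a_j,b_j\in\mathbb{Z}_{\ge0}$, where $\{1\}^a$ denotes $a$ consecutive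 entries equal to $1$; its dual index is $(\{1\}^{b_s},a_s+2,\{1\}^{b_{s-1}},a_{s-1}+2,\ldots,\{1\}^{b_1},a_1+2)$. *)

theory Defs
  imports "HOL-Analysis.Analysis"
begin

definition admissible :: "nat list \<Rightarrow> bool" where
  "admissible ks \<longleftrightarrow> ks \<noteq> [] \<and> (\<forall>k\<in>set ks. 1 \<le> k) \<and> 2 \<le> last ks"

text \<open>Decomposition of an index into blocks (a_j, b_j), i.e.
  (1^{a_1}, b_1+2, ..., 1^{a_s}, b_s+2).  The first argument counts pending 1's.\<close>
fun blocks_aux :: "nat \<Rightarrow> nat list \<Rightarrow> (nat \<times> nat) list" where
  "blocks_aux a [] = []"
| "blocks_aux a (k # ks) =
     (if k = 1 then blocks_aux (Suc a) ks else (a, k - 2) # blocks_aux 0 ks)"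

definition blocks :: "nat list \<Rightarrow> (nat \<times> nat) list" where
  "blocks ks = blocks_aux 0 ks"

definition of_blocks :: "(nat \<times> nat) list \<Rightarrow> nat list" where
  "of_blocks bs = concat (map (\<lambda>(a, b). replicate a 1 @ [b + 2]) bs)"

definition dual_index :: "nat list \<Rightarrow> nat list" where
  "dual_index ks = of_blocks (rev (map (\<lambda>(a, b). (b, a)) (blocks ks)))"

definition incr_tuples :: "nat \<Rightarrow> nat list set" where
  "incr_tuples n = {ms. length ms = n \<and> sorted_wrt (<) ms}"

definition Z_term :: "nat list \<Rightarrow> complex \<Rightarrow> complex \<Rightarrow> nat list \<Rightarrow> complex" where
  "Z_term ks \<alpha> \<beta> ms =
     (pochhammer \<alpha> (hd ms) / fact (hd ms)) *
     (fact (last ms) / pochhammer \<alpha> (last ms + 1)) /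
     ((\<Prod>i<length ks - 1. (of_nat (ms ! i) + \<beta>) ^ (ks ! i)) *
      (of_nat (last ms) + \<beta>) ^ (last ks - 1))"

definition Z2 :: "nat list \<Rightarrow> complex \<Rightarrow> complex \<Rightarrow> complex" where
  "Z2 ks \<alpha> \<beta> = infsum (Z_term ks \<alpha> \<beta>) (incr_tuples (length ks))"

definition Z :: "nat list \<Rightarrow> complex \<Rightarrow> complex" where
  "Z ks \<alpha> = Z2 ks \<alpha> \<alpha>"

definition compositions :: "nat \<Rightarrow> nat \<Rightarrow> nat list set" where
  "compositions n l = {ls. length ls = n \<and> sum_list ls = l}"

end

theory Submission
  imports Defs
begin

text \<open>
  The proof adapts the connected sum method of Seki and Yamamoto. With \<open>w m = (\<alpha>)_m / m!\<close>, the
  generating function in \<open>x\<close> of the left-hand sides replaces each factor \<open>1 / (m_i + \<alpha>)^{k_i}\<close> by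
  \<open>1 / ((m_i + \<alpha>)^{k_i - 1} (m_i + \<gamma>))\<close>, where \<open>\<gamma> = \<alpha> - x\<close>, the boundary weights being
  \<open>w m_1 / w m_n\<close>. Two such sums, for indices \<open>k\<close> and \<open>k'\<close> and without the weight \<open>1 / w\<close> at the end,
  are linked through the symmetric connector
  \<open>C(m, n) = (\<gamma>)_{m+1} (\<gamma>)_{n+1} / (\<alpha> + \<gamma>)_{m+n+1}\<close>. Since
  \<open>C(m, n) / (m + \<alpha>)\<close> is the telescoping sum of \<open>C(m, b) / (b + \<gamma>)\<close> over \<open>b > n\<close>, one may lower the
  last entry of \<open>k\<close> at the price of appending a 1 to \<open>k'\<close>, and conversely; this moves \<open>k\<close> to the other
  side and turns it into its dual. At both ends of the process the weight \<open>1 / w\<close> is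
  produced by Gauss's summation theorem, with the same constant. Absolute convergence follows by
  comparison with the case of real \<open>\<alpha>\<close> and \<open>x\<close>, where all terms are nonnegative and the same transport
  steps reduce it to a single series.
\<close>

section \<open>Pochhammer bounds and the connector\<close>

lemma pochhammer_mono:
  fixes a b :: real
  assumes "0 < a" "a \<le> b"
  shows "pochhammer a n \<le> pochhammer b n"
  unfolding pochhammer_prod using assms by (intro prod_mono) auto

lemma pochhammer_Re_le_norm:
  assumes "0 < Re z"
  shows "pochhammer (Re z) n \<le> norm (pochhammer z n)"
  unfolding pochhammer_prod prod_norm[symmetric]
proof (intro prod_mono conjI)
  fix i
  show "0 \<le> Re z + of_nat i" using assms by simp
  show "Re z + of_nat i \<le> norm (z + of_nat i)"
    using complex_Re_le_cmod[of "z + of_nat i"] by simp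
qed

lemma nonpos_Ints_Re: "0 < Re z \<Longrightarrow> z \<notin> \<int>\<^sub>\<le>\<^sub>0"
  by (auto elim!: nonpos_Ints_cases)

lemma nonpos_Ints_pos: "0 < (x::real) \<Longrightarrow> x \<notin> \<int>\<^sub>\<le>\<^sub>0"
  by (auto elim!: nonpos_Ints_cases)

lemma pochhammer_nonzero:
  fixes z :: "'a :: field_char_0"
  assumes "z \<notin> \<int>\<^sub>\<le>\<^sub>0"
  shows "pochhammer z n \<noteq> 0"
  using assms by (auto simp: pochhammer_eq_0_iff)

lemma add_of_nat_nonzero:
  fixes z :: "'a :: field_char_0"
  assumes "z \<notin> \<int>\<^sub>\<le>\<^sub>0"
  shows "z + of_nat n \<noteq> 0" "of_nat n + z \<noteq> 0"
  using assms by (metis add.commute add_eq_0_iff minus_of_nat_in_nonpos_Ints minus_minus)+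

text \<open>In Euler's limit for 1/Gamma the powers n^z and n^(Re z) have the same modulus, so the
  ratio of the two Pochhammer symbols converges and is therefore bounded.\<close>

lemma norm_pochhammer_le:
  assumes "0 < Re z"
  obtains K where "0 < K" "\<And>n. norm (pochhammer z n) \<le> K * pochhammer (Re z) n"
proof -
  define q where "q n = norm (pochhammer z (Suc n)) / pochhammer (Re z) (Suc n)" for n
  have pos: "0 < pochhammer (Re z) n" for n using assms by (rule pochhammer_pos)
  have "(\<lambda>n. norm (rGamma_series z n) / rGamma_series (Re z) n) \<longlonglongrightarrow> norm (rGamma z) / rGamma (Re z)"
    using nonpos_Ints_pos[OF assms]
    by (intro tendsto_intros) (simp add: rGamma_eq_zero_iff)
  also have "(\<lambda>n. norm (rGamma_series z n) / rGamma_series (Re z) n) = q"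
    by (simp add: fun_eq_iff q_def rGamma_series_def norm_divide norm_mult)
  finally have "Bseq q"
    using convergent_imp_Bseq convergentI by blast
  then obtain K where K: "0 < K" "\<And>n. norm (q n) \<le> K"
    by (auto simp: Bseq_def)
  \<comment> \<open>\<open>q\<close> covers only positive lengths; the empty symbol needs a constant
    of at least 1.\<close>
  show ?thesis
  proof (rule that[of "max K 1"])
    fix n
    show "norm (pochhammer z n) \<le> max K 1 * pochhammer (Re z) n"
    proof (cases n)
      case (Suc k)
      have "norm (pochhammer z n) \<le> K * pochhammer (Re z) n"
        using K(2)[of k] pos[of n] unfolding q_def Suc by (simp add: divide_le_eq)
      also have "\<dots> \<le> max K 1 * pochhammer (Re z) n"
        using pos[of n] by (intro mult_right_mono) auto
      finally show ?thesis .
    qed auto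
  qed auto
qed

section \<open>The connector and its telescoping sum\<close>

definition connector :: "'a::real_normed_field \<Rightarrow> 'a \<Rightarrow> nat \<Rightarrow> nat \<Rightarrow> 'a" where
  "connector \<alpha> \<gamma> m n =
     pochhammer \<gamma> (m + 1) * pochhammer \<gamma> (n + 1) / pochhammer (\<alpha> + \<gamma>) (m + n + 1)"

lemma connector_commute: "connector \<alpha> \<gamma> m n = connector \<alpha> \<gamma> n m"
  by (simp add: connector_def add.commute mult.commute)

lemma connector_nonneg: "0 < \<alpha> \<Longrightarrow> 0 < \<gamma> \<Longrightarrow> 0 \<le> connector \<alpha> \<gamma> m (n::nat)" for \<alpha> :: real
  unfolding connector_def by (intro divide_nonneg_nonneg mult_nonneg_nonneg pochhammer_nonneg) auto

text \<open>Raising b by one multiplies the connector by \<open>B / R\<close> with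
  \<open>R = of_nat m + \<alpha> + B\<close>, and 1 - B / R equals (m + \<alpha>) / R.\<close>

lemma connector_diff:
  fixes \<alpha> \<gamma> :: "'a::real_normed_field"
  assumes "\<gamma> \<notin> \<int>\<^sub>\<le>\<^sub>0" "\<alpha> + \<gamma> \<notin> \<int>\<^sub>\<le>\<^sub>0"
  shows "connector \<alpha> \<gamma> m b - connector \<alpha> \<gamma> m (Suc b) =
    (of_nat m + \<alpha>) * (connector \<alpha> \<gamma> m (Suc b) / (of_nat (Suc b) + \<gamma>))"
proof -
  define p where "p = pochhammer \<gamma> (m + 1)"
  define q where "q = pochhammer \<gamma> (b + 1)"
  define r where "r = pochhammer (\<alpha> + \<gamma>) (m + b + 1)"
  define B where "B = of_nat (Suc b) + \<gamma>"
  define R where "R = of_nat m + \<alpha> + B"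
  have nz: "r \<noteq> 0" "B \<noteq> 0"
    using assms add_of_nat_nonzero(2)[OF assms(1), of "Suc b"]
    by (simp_all add: r_def B_def pochhammer_nonzero del: of_nat_Suc)
  have Rnz: "R \<noteq> 0"
    using add_of_nat_nonzero(1)[OF assms(2), of "m + b + 1"] by (simp add: R_def B_def algebra_simps)
  have c0: "connector \<alpha> \<gamma> m b = p * q / r"
    by (simp add: connector_def p_def q_def r_def)
  have c1: "connector \<alpha> \<gamma> m (Suc b) = p * (q * B) / (r * R)"
    by (simp add: connector_def p_def q_def r_def R_def B_def pochhammer_Suc algebra_simps)
  have "p * q / r - p * (q * B) / (r * R) = (R - B) * (p * (q * B) / (r * R) / B)"
    using nz Rnz by (simp add: field_simps)
  then show ?thesis unfolding c0 c1 by (simp add: R_def B_def)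
qed

text \<open>Dividing the Euler limits for \<gamma> and \<alpha> + \<gamma> leaves the power
  n^(-\<alpha>), so \<open>q\<close> tends to 0. The other m factors of the denominator are bounded
  below by a Pochhammer symbol independent of n.\<close>

lemma connector_tendsto_zero_real:
  fixes \<alpha> \<gamma> :: real
  assumes "0 < \<alpha>" "0 < \<gamma>"
  shows "connector \<alpha> \<gamma> m \<longlonglongrightarrow> 0"
proof -
  define q where "q n = pochhammer \<gamma> (n + 1) / pochhammer (\<alpha> + \<gamma>) (n + 1)" for n
  have np: "\<alpha> + \<gamma> \<notin> \<int>\<^sub>\<le>\<^sub>0" using assms by (intro nonpos_Ints_pos) auto
  have "((\<lambda>n. exp (- \<alpha> * ln (real n))) \<longlongrightarrow> 0) sequentially"
  proof (rule filterlim_compose[OF exp_at_bot])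
    show "filterlim (\<lambda>n. - \<alpha> * ln (real n)) at_bot sequentially"
      using assms(1) filterlim_compose[OF ln_at_top filterlim_real_sequentially]
      by (intro filterlim_tendsto_neg_mult_at_bot[OF tendsto_const]) auto
  qed
  then have "(\<lambda>n. rGamma_series \<gamma> n / rGamma_series (\<alpha> + \<gamma>) n * exp (- \<alpha> * ln (real n)))
      \<longlonglongrightarrow> rGamma \<gamma> / rGamma (\<alpha> + \<gamma>) * 0"
    using np by (intro tendsto_intros) (auto simp: rGamma_eq_zero_iff)
  also have "(\<lambda>n. rGamma_series \<gamma> n / rGamma_series (\<alpha> + \<gamma>) n * exp (- \<alpha> * ln (real n))) = q"
    by (rule ext) (simp add: q_def rGamma_series_def exp_minus exp_add algebra_simps divide_simps)
  finally have q: "q \<longlonglongrightarrow> 0" by simp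
  define c where "c = pochhammer \<gamma> (m + 1) / pochhammer (\<alpha> + \<gamma>) m"
  have "(\<lambda>n. c * q n) \<longlonglongrightarrow> 0" using tendsto_mult_right_zero[OF q] by simp
  then show ?thesis
  proof (rule tendsto_sandwich[rotated 3])
    show "\<forall>\<^sub>F n in sequentially. connector \<alpha> \<gamma> m n \<le> c * q n"
    proof (rule always_eventually, rule allI)
      fix n
      let ?s = "\<alpha> + \<gamma>"
      have pos: "0 < pochhammer ?s k" for k using assms by (intro pochhammer_pos) auto
      have "pochhammer ?s (n + 1 + m) = pochhammer ?s (n + 1) * pochhammer (?s + of_nat (n + 1)) m"
        by (rule pochhammer_product')
      also have "\<dots> \<ge> pochhammer ?s (n + 1) * pochhammer ?s m"
        using assms pos[of "n + 1"]
        by (intro mult_left_mono pochhammer_mono) auto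
      finally have *: "pochhammer ?s (n + 1) * pochhammer ?s m \<le> pochhammer ?s (m + n + 1)"
        by (simp add: add_ac)
      have "connector \<alpha> \<gamma> m n \<le> pochhammer \<gamma> (m + 1) * pochhammer \<gamma> (n + 1) /
          (pochhammer ?s (n + 1) * pochhammer ?s m)"
        unfolding connector_def using pos[of "n+1"] pos[of m] pos[of "m + n + 1"] assms
        by (intro divide_left_mono * mult_nonneg_nonneg mult_pos_pos pochhammer_nonneg) auto
      then show "connector \<alpha> \<gamma> m n \<le> c * q n" by (simp add: c_def q_def mult_ac)
    qed
  qed (use connector_nonneg[OF assms] in auto)
qed

text \<open>Each Pochhammer symbol in the numerator costs a factor \<open>K\<close>; the denominator
  is bounded below by its value at the real parts. This carries convergence from real to complex
  parameters.\<close>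

lemma norm_connector_le:
  assumes "0 < Re \<alpha>" "0 < Re \<gamma>"
  obtains K where "0 < K" "\<And>m n. norm (connector \<alpha> \<gamma> m n) \<le> K * connector (Re \<alpha>) (Re \<gamma>) m n"
proof -
  obtain K where K: "0 < K" "\<And>n. norm (pochhammer \<gamma> n) \<le> K * pochhammer (Re \<gamma>) n"
    using norm_pochhammer_le[OF assms(2)] by blast
  show ?thesis
  proof (rule that[of "K * K"])
    fix m n
    let ?s = "\<alpha> + \<gamma>"
    have "norm (connector \<alpha> \<gamma> m n) \<le> (K * pochhammer (Re \<gamma>) (m + 1)) * (K * pochhammer (Re \<gamma>) (n + 1))
        / pochhammer (Re ?s) (m + n + 1)"
      unfolding connector_def norm_divide norm_mult
      using K assms by (intro frac_le mult_mono mult_nonneg_nonneg pochhammer_nonneg pochhammer_pos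
          pochhammer_Re_le_norm) auto
    then show "norm (connector \<alpha> \<gamma> m n) \<le> K * K * connector (Re \<alpha>) (Re \<gamma>) m n"
      by (simp add: connector_def mult_ac)
  qed (use K in auto)
qed

lemma connector_tendsto_zero:
  assumes "0 < Re \<alpha>" "0 < Re \<gamma>"
  shows "connector \<alpha> \<gamma> m \<longlonglongrightarrow> 0"
proof -
  obtain K where "\<And>m n. norm (connector \<alpha> \<gamma> m n) \<le> K * connector (Re \<alpha>) (Re \<gamma>) m n"
    using norm_connector_le[OF assms] by blast
  moreover have "(\<lambda>n. K * connector (Re \<alpha>) (Re \<gamma>) m n) \<longlonglongrightarrow> 0"
    using connector_tendsto_zero_real[OF assms] by (rule tendsto_mult_right_zero)
  ultimately show ?thesis
    by (intro Lim_null_comparison[of "connector \<alpha> \<gamma> m"]) (auto intro!: always_eventually)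
qed

text \<open>\<open>connector_diff\<close> divided by m + \<alpha> writes each term as a difference
  of consecutive connector values.\<close>

lemma connector_sums:
  fixes \<alpha> \<gamma> :: "'a::real_normed_field"
  assumes "\<alpha> \<notin> \<int>\<^sub>\<le>\<^sub>0" "\<gamma> \<notin> \<int>\<^sub>\<le>\<^sub>0" "\<alpha> + \<gamma> \<notin> \<int>\<^sub>\<le>\<^sub>0" and lim: "connector \<alpha> \<gamma> m \<longlonglongrightarrow> 0"
  shows "(\<lambda>j. connector \<alpha> \<gamma> m (Suc (n + j)) / (of_nat (Suc (n + j)) + \<gamma>)) sums
    (connector \<alpha> \<gamma> m n / (of_nat m + \<alpha>))"
proof -
  define f where "f j = connector \<alpha> \<gamma> m (n + j)" for j
  have "f \<longlonglongrightarrow> 0" unfolding f_def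
    using LIMSEQ_ignore_initial_segment[OF lim, of n] by (simp add: add.commute)
  then have "(\<lambda>j. f j - f (Suc j)) sums (f 0 - 0)"
    by (rule telescope_sums')
  then have "(\<lambda>j. (f j - f (Suc j)) / (of_nat m + \<alpha>)) sums ((f 0 - 0) / (of_nat m + \<alpha>))"
    by (rule sums_divide)
  moreover have "(f j - f (Suc j)) / (of_nat m + \<alpha>) =
      connector \<alpha> \<gamma> m (Suc (n + j)) / (of_nat (Suc (n + j)) + \<gamma>)" for j
    using connector_diff[OF assms(2,3), of m "n + j"] add_of_nat_nonzero(2)[OF assms(1), of m]
    by (simp add: f_def)
  ultimately show ?thesis by (simp add: f_def)
qed

section \<open>Gauss's summation theorem\<close>

text \<open>For m = 0 the sequence is a quotient of Euler limits in which the powers of n cancel.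
  Each further step in m divides by a quantity that tends to infinity with b, which makes the limit
  0.\<close>

lemma gauss_telescope_tendsto:
  fixes \<alpha> \<gamma> :: "'a::Gamma"
  assumes "\<alpha> + \<gamma> \<notin> \<int>\<^sub>\<le>\<^sub>0"
  defines "T \<equiv> \<lambda>m b. of_nat b * (pochhammer \<alpha> b * pochhammer \<gamma> b / (fact b * pochhammer (\<alpha> + \<gamma>) (b + m)))"
  shows "T m \<longlonglongrightarrow> (if m = 0 then rGamma \<alpha> * rGamma \<gamma> / rGamma (\<alpha> + \<gamma>) else 0)"
proof -
  let ?c = "rGamma \<alpha> * rGamma \<gamma> / rGamma (\<alpha> + \<gamma>)"
  have T0: "T 0 \<longlonglongrightarrow> ?c"
  proof -
    have "(\<lambda>n. rGamma_series \<alpha> n * rGamma_series \<gamma> n / rGamma_series (\<alpha> + \<gamma>) n) \<longlonglongrightarrow> ?c"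
      using assms(1) by (intro tendsto_intros) (auto simp: rGamma_eq_zero_iff)
    \<comment> \<open>The shift to \<open>Suc n\<close> turns (n + 1) / (n + 1)! into 1 / n!, the
      factorial in the Euler limit.\<close>
    moreover have "rGamma_series \<alpha> n * rGamma_series \<gamma> n / rGamma_series (\<alpha> + \<gamma>) n = T 0 (Suc n)" for n
    proof -
      define P Q R where "P = pochhammer \<alpha> (Suc n)" and "Q = pochhammer \<gamma> (Suc n)"
        and "R = pochhammer (\<alpha> + \<gamma>) (Suc n)"
      define x y where "x = exp (\<alpha> * of_real (ln (real n)))" and "y = exp (\<gamma> * of_real (ln (real n)))"
      have xy: "exp ((\<alpha> + \<gamma>) * of_real (ln (real n))) = x * y"
        by (simp add: x_def y_def exp_add distrib_right)
      have nz: "x \<noteq> 0" "y \<noteq> 0" "R \<noteq> 0" "(fact n :: 'a) \<noteq> 0" "(of_nat (Suc n) :: 'a) \<noteq> 0"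
        using assms(1) by (simp_all add: x_def y_def R_def pochhammer_nonzero del: of_nat_Suc)
      show ?thesis
        unfolding rGamma_series_def T_def fact_Suc add_0_right Suc_eq_plus1[symmetric] xy
          P_def[symmetric] Q_def[symmetric] R_def[symmetric] x_def[symmetric] y_def[symmetric]
        using nz by (simp add: field_simps del: of_nat_Suc)
    qed
    ultimately have "(\<lambda>n. T 0 (Suc n)) \<longlonglongrightarrow> ?c" by simp
    then show ?thesis by (rule LIMSEQ_imp_Suc)
  qed
  have step: "T (Suc m) \<longlonglongrightarrow> 0" if "T m \<longlonglongrightarrow> l" for m l
  proof -
    have "filterlim (\<lambda>b. (\<alpha> + \<gamma> + of_nat m) + of_nat b :: 'a) at_infinity sequentially"
      by (rule tendsto_add_filterlim_at_infinity[OF tendsto_const tendsto_of_nat])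
    then have "(\<lambda>b. T m b / ((\<alpha> + \<gamma> + of_nat m) + of_nat b)) \<longlonglongrightarrow> 0"
      by (rule tendsto_divide_0[OF that])
    moreover have "T m b / ((\<alpha> + \<gamma> + of_nat m) + of_nat b) = T (Suc m) b" for b
      by (simp add: T_def pochhammer_Suc algebra_simps)
    ultimately show ?thesis by simp
  qed
  have "T (Suc m) \<longlonglongrightarrow> 0" for m
    by (induction m) (use step T0 in auto)
  then show ?thesis using T0 by (cases m) auto
qed

text \<open>Gauss's evaluation of \<open>2F1(a, b; c; 1)\<close> for \<open>a = \<alpha>\<close>, \<open>b = \<gamma>\<close>, \<open>c = \<alpha> + \<gamma> + m + 1\<close>: the sequence \<open>T m\<close>
  telescopes to the contiguity relation between the values for \<open>m\<close> and \<open>m - 1\<close>.\<close>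
lemma connector_gauss_sums:
  fixes \<alpha> \<gamma> :: "'a::Gamma"
  assumes "\<alpha> \<notin> \<int>\<^sub>\<le>\<^sub>0" "\<gamma> \<notin> \<int>\<^sub>\<le>\<^sub>0" "\<alpha> + \<gamma> \<notin> \<int>\<^sub>\<le>\<^sub>0"
  shows "(\<lambda>b. pochhammer \<alpha> b / fact b / (of_nat b + \<gamma>) * connector \<alpha> \<gamma> m b) sums
    (rGamma \<alpha> * rGamma \<gamma> / rGamma (\<alpha> + \<gamma>) * (fact m / pochhammer \<alpha> (m + 1)))"
proof -
  let ?c = "rGamma \<alpha> * rGamma \<gamma> / rGamma (\<alpha> + \<gamma>)" and ?s = "\<alpha> + \<gamma>"
  define T where "T \<equiv> \<lambda>m b. of_nat b * (pochhammer \<alpha> b * pochhammer \<gamma> b / (fact b * pochhammer ?s (b + m)))"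
  define e where "e m b = pochhammer \<alpha> b * pochhammer \<gamma> b / (fact b * pochhammer ?s (m + b + 1))" for m b
  have lim: "T m \<longlonglongrightarrow> (if m = 0 then ?c else 0)" for m
    unfolding T_def by (rule gauss_telescope_tendsto[OF assms(3)])
  have snz: "?s + of_nat n \<noteq> 0" for n using add_of_nat_nonzero(1)[OF assms(3)] .
  have diff: "T m (Suc b) - T m b = e m b * (\<alpha> * \<gamma> - of_nat (b * m))" for m b
  proof -
    define W where "W = pochhammer \<alpha> b * pochhammer \<gamma> b / (fact b * pochhammer ?s (b + m))"
    have E: "e m b = W / (?s + of_nat (b + m))"
      by (simp add: e_def W_def pochhammer_Suc add_ac)
    have "T m (Suc b) = (\<alpha> + of_nat b) * (\<gamma> + of_nat b) * W / (?s + of_nat (b + m))"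
    proof -
      have *: "N * (P * A * (Q * B) / (N * F * (R * S))) = A * B * (P * Q / (F * R)) / S"
        if "N \<noteq> 0" for N P A Q B F R S :: 'a
        using that by (simp add: mult_ac)
      show ?thesis
        unfolding T_def W_def pochhammer_Suc fact_Suc add_Suc of_nat_mult
        by (rule *) (simp del: of_nat_Suc)
    qed
    moreover have "T m b = of_nat b * W" by (simp add: T_def W_def)
    moreover have "(\<alpha> + of_nat b) * (\<gamma> + of_nat b) * W / (?s + of_nat (b + m)) - of_nat b * W =
      W / (?s + of_nat (b + m)) * ((\<alpha> + of_nat b) * (\<gamma> + of_nat b) - of_nat b * (?s + of_nat (b + m)))"
      using snz[of "b + m"] by (simp add: field_simps del: of_nat_add)
    ultimately show ?thesis unfolding E by (simp add: algebra_simps)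
  qed
  have e_rec: "e m b = (?s + of_nat (b + Suc m)) * e (Suc m) b" for m b
  proof -
    have "pochhammer ?s (Suc m + b + 1) = pochhammer ?s (m + b + 1) * (?s + of_nat (b + Suc m))"
      by (simp add: pochhammer_Suc algebra_simps)
    then show ?thesis using snz[of "b + Suc m"] unfolding e_def by (simp del: of_nat_add of_nat_Suc)
  qed
  have tel: "(\<lambda>b. T m (Suc b) - T m b) sums (if m = 0 then ?c else 0)" for m
    using telescope_sums[OF lim[of m]] by (simp add: T_def)
  have nz: "\<alpha> + of_nat n \<noteq> 0" "\<gamma> + of_nat n \<noteq> 0" for n
    using assms add_of_nat_nonzero by blast+
  have nz0: "\<alpha> \<noteq> 0" "\<gamma> \<noteq> 0" using nz[of 0] by auto
  have main: "e m sums (?c * fact m / (pochhammer \<alpha> (m + 1) * pochhammer \<gamma> (m + 1)))" for m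
  proof (induction m)
    case 0
    have "(\<lambda>b. e 0 b * (\<alpha> * \<gamma>)) sums ?c" using tel[of 0] by (simp add: diff)
    then have "(\<lambda>b. e 0 b * (\<alpha> * \<gamma>) / (\<alpha> * \<gamma>)) sums (?c / (\<alpha> * \<gamma>))" by (rule sums_divide)
    then show ?case using nz0 by simp
  next
    case (Suc m)
    let ?k = "(\<alpha> + of_nat (Suc m)) * (\<gamma> + of_nat (Suc m))"
    \<comment> \<open>With s = \<alpha> + \<gamma>, the identity (m + 1) (s + b + m + 1) + \<alpha>
      \<gamma> - b (m + 1) = (\<alpha> + m + 1) (\<gamma> + m + 1) removes b from the factor, so the
      sums for m and m + 1 differ by a constant factor.\<close>
    have eq: "?k * e (Suc m) b = of_nat (Suc m) * e m b + (T (Suc m) (Suc b) - T (Suc m) b)" for b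
      unfolding diff e_rec[of m b] by (simp add: algebra_simps)
    have "(\<lambda>b. of_nat (Suc m) * e m b + (T (Suc m) (Suc b) - T (Suc m) b)) sums
      (of_nat (Suc m) * (?c * fact m / (pochhammer \<alpha> (m + 1) * pochhammer \<gamma> (m + 1))) + 0)"
      using tel[of "Suc m"] by (intro sums_add sums_mult Suc) auto
    then have "(\<lambda>b. ?k * e (Suc m) b / ?k) sums
      ((of_nat (Suc m) * (?c * fact m / (pochhammer \<alpha> (m + 1) * pochhammer \<gamma> (m + 1)))) / ?k)"
      unfolding eq[symmetric] by (intro sums_divide) simp
    then show ?case
      using nz[of "Suc m"] by (simp add: pochhammer_Suc mult_ac del: of_nat_Suc)
  qed
  have "(\<lambda>b. pochhammer \<gamma> (m + 1) * e m b) sums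
     (pochhammer \<gamma> (m + 1) * (?c * fact m / (pochhammer \<alpha> (m + 1) * pochhammer \<gamma> (m + 1))))"
    by (intro sums_mult main)
  moreover have "pochhammer \<gamma> (m + 1) * e m b =
      pochhammer \<alpha> b / fact b / (of_nat b + \<gamma>) * connector \<alpha> \<gamma> m b" for b
  proof -
    have *: "G * (A * B / (F * S)) = A / F / g * (G * (B * g) / S)" if "g \<noteq> 0" for A B F G S g :: 'a
      using that by simp
    show ?thesis
      unfolding e_def connector_def Suc_eq_plus1[symmetric] pochhammer_Suc[of \<gamma> b]
        add.commute[of "of_nat b" \<gamma>]
      by (rule *) (rule nz(2))
  qed
  ultimately show ?thesis
    using pochhammer_nonzero[OF assms(2), of "m + 1"] by (simp add: field_simps)
qed

section \<open>Connected sums\<close>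

text \<open>A word encodes an index read from its end: \<open>False\<close> raises the last entry by one, \<open>True\<close> appends
  a new entry 1, and \<open>[]\<close> is the index (1). The parameter \<open>\<gamma>\<close> stands for \<open>\<alpha> - x\<close>, with \<open>x\<close> the
  variable of the generating function, and the last summation variable is fixed to be \<open>m\<close>.\<close>
primrec head_sum :: "'a::real_normed_field \<Rightarrow> 'a \<Rightarrow> bool list \<Rightarrow> nat \<Rightarrow> 'a" where
  "head_sum \<alpha> \<gamma> [] m = pochhammer \<alpha> m / fact m / (of_nat m + \<gamma>)"
| "head_sum \<alpha> \<gamma> (c # v) m =
     (if c then (\<Sum>k<m. head_sum \<alpha> \<gamma> v k) / (of_nat m + \<gamma>)
      else head_sum \<alpha> \<gamma> v m / (of_nat m + \<alpha>))"

lemma head_sum_nonneg: "0 < \<alpha> \<Longrightarrow> 0 < \<gamma> \<Longrightarrow> 0 \<le> head_sum \<alpha> \<gamma> v m" for \<alpha> :: real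
  by (induction v arbitrary: m) (auto intro!: divide_nonneg_nonneg sum_nonneg pochhammer_nonneg)

lemma Re_add_of_nat_le_norm: "real n + Re z \<le> norm (of_nat n + z)"
  using complex_Re_le_cmod[of "of_nat n + z"] by simp

text \<open>The Pochhammer symbol occurs only at the innermost variable, so a single
  \<open>K\<close> serves all words and all m; the denominators are bounded below by their values at
  the real parts.\<close>

lemma norm_head_sum_le:
  assumes "0 < Re \<alpha>" "0 < Re \<gamma>"
  obtains K where "0 < K" "\<And>v m. norm (head_sum \<alpha> \<gamma> v m) \<le> K * head_sum (Re \<alpha>) (Re \<gamma>) v m"
proof -
  obtain K where K: "0 < K" "\<And>n. norm (pochhammer \<alpha> n) \<le> K * pochhammer (Re \<alpha>) n"
    using norm_pochhammer_le[OF assms(1)] by blast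
  have "norm (head_sum \<alpha> \<gamma> v m) \<le> K * head_sum (Re \<alpha>) (Re \<gamma>) v m" for v m
  proof (induction v arbitrary: m)
    case Nil
    have "norm (head_sum \<alpha> \<gamma> [] m) \<le> K * pochhammer (Re \<alpha>) m / fact m / (of_nat m + Re \<gamma>)"
      unfolding head_sum.simps norm_divide using K assms Re_add_of_nat_le_norm
      by (intro frac_le) (auto intro!: mult_nonneg_nonneg divide_nonneg_nonneg divide_right_mono pochhammer_nonneg)
    then show ?case by simp
  next
    case (Cons c v)
    have nn: "0 \<le> head_sum (Re \<alpha>) (Re \<gamma>) v m" for m using head_sum_nonneg[OF assms] .
    show ?case
    proof (cases c)
      case True
      have "norm (\<Sum>k<m. head_sum \<alpha> \<gamma> v k) \<le> (\<Sum>k<m. K * head_sum (Re \<alpha>) (Re \<gamma>) v k)"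
        by (intro order.trans[OF norm_sum] sum_mono Cons.IH)
      then have "norm (\<Sum>k<m. head_sum \<alpha> \<gamma> v k) / norm (of_nat m + \<gamma>) \<le>
          (\<Sum>k<m. K * head_sum (Re \<alpha>) (Re \<gamma>) v k) / (of_nat m + Re \<gamma>)"
        using assms K nn Re_add_of_nat_le_norm by (intro frac_le) (auto intro!: sum_nonneg mult_nonneg_nonneg)
      then show ?thesis using True by (simp add: norm_divide sum_distrib_left)
    next
      case False
      have "norm (head_sum \<alpha> \<gamma> v m) / norm (of_nat m + \<alpha>) \<le>
          (K * head_sum (Re \<alpha>) (Re \<gamma>) v m) / (of_nat m + Re \<alpha>)"
        using assms K nn Re_add_of_nat_le_norm Cons.IH by (intro frac_le) (auto intro!: mult_nonneg_nonneg)
      then show ?thesis using False by (simp add: norm_divide)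
    qed
  qed
  with K(1) show ?thesis using that by blast
qed

section \<open>Unconditional summation of the connector and of Gauss's series\<close>

lemma has_sum_greaterThan:
  fixes h :: "nat \<Rightarrow> 'a::{comm_monoid_add,topological_space}"
  assumes "((\<lambda>j. h (Suc (n + j))) has_sum s) UNIV"
  shows "(h has_sum s) {n<..}"
proof -
  have "bij_betw (\<lambda>j. Suc (n + j)) UNIV {n<..}"
    by (rule bij_betwI[of _ _ _ "\<lambda>b. b - Suc n"]) auto
  from has_sum_reindex_bij_betw[OF this, of h s] assms show ?thesis by simp
qed

lemma connector_has_sum_real:
  fixes \<alpha> \<gamma> :: real
  assumes "0 < \<alpha>" "0 < \<gamma>"
  shows "((\<lambda>b. connector \<alpha> \<gamma> m b / (of_nat b + \<gamma>)) has_sum (connector \<alpha> \<gamma> m n / (of_nat m + \<alpha>))) {n<..}"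
  using assms connector_nonneg[OF assms]
  by (intro has_sum_greaterThan sums_nonneg_imp_has_sum connector_sums connector_tendsto_zero_real
      nonpos_Ints_pos divide_nonneg_nonneg) auto

lemma norm_connector_divide_le:
  assumes "0 < Re \<alpha>" "0 < Re \<gamma>"
  obtains K where "0 < K" "\<And>m b. norm (connector \<alpha> \<gamma> m b / (of_nat b + \<gamma>)) \<le>
    K * (connector (Re \<alpha>) (Re \<gamma>) m b / (of_nat b + Re \<gamma>))"
proof -
  obtain K where K: "0 < K" "\<And>m n. norm (connector \<alpha> \<gamma> m n) \<le> K * connector (Re \<alpha>) (Re \<gamma>) m n"
    using norm_connector_le[OF assms] by blast
  have "norm (connector \<alpha> \<gamma> m b / (of_nat b + \<gamma>)) \<le>
      (K * connector (Re \<alpha>) (Re \<gamma>) m b) / (of_nat b + Re \<gamma>)" for m b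
    unfolding norm_divide using K assms Re_add_of_nat_le_norm connector_nonneg[OF assms]
    by (intro frac_le) (auto intro!: mult_nonneg_nonneg)
  with K(1) show ?thesis by (intro that[of K]) auto
qed

text \<open>Telescoping gives the value; comparison with the nonnegative series at the real parts
  gives the absolute convergence behind the unordered sum.\<close>

lemma connector_has_sum:
  assumes "0 < Re \<alpha>" "0 < Re \<gamma>"
  shows "((\<lambda>b. connector \<alpha> \<gamma> m b / (of_nat b + \<gamma>)) has_sum (connector \<alpha> \<gamma> m n / (of_nat m + \<alpha>))) {n<..}"
proof (intro has_sum_greaterThan norm_summable_imp_has_sum)
  obtain K where K: "\<And>m b. norm (connector \<alpha> \<gamma> m b / (of_nat b + \<gamma>)) \<le>
      K * (connector (Re \<alpha>) (Re \<gamma>) m b / (of_nat b + Re \<gamma>))"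
    using norm_connector_divide_le[OF assms] by blast
  have "summable (\<lambda>j. K * (connector (Re \<alpha>) (Re \<gamma>) m (Suc (n + j)) / (of_nat (Suc (n + j)) + Re \<gamma>)))"
    using assms
    by (intro summable_mult sums_summable[OF connector_sums] nonpos_Ints_pos connector_tendsto_zero_real) auto
  then show "summable (\<lambda>j. norm (connector \<alpha> \<gamma> m (Suc (n + j)) / (of_nat (Suc (n + j)) + \<gamma>)))"
    by (rule summable_comparison_test[OF exI, rotated]) (use K in \<open>simp del: of_nat_Suc\<close>)
  show "(\<lambda>j. connector \<alpha> \<gamma> m (Suc (n + j)) / (of_nat (Suc (n + j)) + \<gamma>)) sums
      (connector \<alpha> \<gamma> m n / (of_nat m + \<alpha>))"
    using assms by (intro connector_sums nonpos_Ints_Re connector_tendsto_zero) auto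
qed

text \<open>For parameters with positive real part this is the reciprocal of the Beta function. It
  depends neither on m nor on a word, so it is the same on both sides of the duality.\<close>

definition gauss_const :: "'a::Gamma \<Rightarrow> 'a \<Rightarrow> 'a" where
  "gauss_const \<alpha> \<gamma> = rGamma \<alpha> * rGamma \<gamma> / rGamma (\<alpha> + \<gamma>)"

lemma gauss_const_nonzero:
  assumes "0 < Re \<alpha>" "0 < Re \<gamma>"
  shows "gauss_const \<alpha> \<gamma> \<noteq> 0"
  using assms nonpos_Ints_Re[of \<alpha>] nonpos_Ints_Re[of \<gamma>] nonpos_Ints_Re[of "\<alpha> + \<gamma>"]
  by (auto simp: gauss_const_def rGamma_eq_zero_iff)

lemma gauss_has_sum_real:
  fixes \<alpha> \<gamma> :: real
  assumes "0 < \<alpha>" "0 < \<gamma>"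
  shows "((\<lambda>b. connector \<alpha> \<gamma> m b * head_sum \<alpha> \<gamma> [] b) has_sum
    (gauss_const \<alpha> \<gamma> * (fact m / pochhammer \<alpha> (m + 1)))) UNIV"
  using assms connector_gauss_sums[of \<alpha> \<gamma> m] connector_nonneg[OF assms] head_sum_nonneg[OF assms, of "[]"]
    nonpos_Ints_pos
  by (intro sums_nonneg_imp_has_sum mult_nonneg_nonneg) (auto simp: gauss_const_def mult.commute)

lemma gauss_has_sum:
  assumes "0 < Re \<alpha>" "0 < Re \<gamma>"
  shows "((\<lambda>b. connector \<alpha> \<gamma> m b * head_sum \<alpha> \<gamma> [] b) has_sum
    (gauss_const \<alpha> \<gamma> * (fact m / pochhammer \<alpha> (m + 1)))) UNIV"
proof (rule norm_summable_imp_has_sum)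
  obtain K where K: "0 < K" "\<And>m n. norm (connector \<alpha> \<gamma> m n) \<le> K * connector (Re \<alpha>) (Re \<gamma>) m n"
    using norm_connector_le[OF assms] by blast
  obtain L where L: "0 < L" "\<And>v m. norm (head_sum \<alpha> \<gamma> v m) \<le> L * head_sum (Re \<alpha>) (Re \<gamma>) v m"
    using norm_head_sum_le[OF assms] by blast
  have "summable (\<lambda>b. connector (Re \<alpha>) (Re \<gamma>) m b * head_sum (Re \<alpha>) (Re \<gamma>) [] b)"
    using gauss_has_sum_real[OF assms] has_sum_imp_sums sums_summable by blast
  then have "summable (\<lambda>b. K * L * (connector (Re \<alpha>) (Re \<gamma>) m b * head_sum (Re \<alpha>) (Re \<gamma>) [] b))"
    by (rule summable_mult)
  then show "summable (\<lambda>b. norm (connector \<alpha> \<gamma> m b * head_sum \<alpha> \<gamma> [] b))"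
  proof (rule summable_comparison_test[OF exI, rotated], intro allI impI)
    fix b
    have "norm (connector \<alpha> \<gamma> m b) * norm (head_sum \<alpha> \<gamma> [] b) \<le>
      (K * connector (Re \<alpha>) (Re \<gamma>) m b) * (L * head_sum (Re \<alpha>) (Re \<gamma>) [] b)"
      using K(1) by (intro mult_mono K(2) L(2) mult_nonneg_nonneg connector_nonneg assms) auto
    then show "norm (norm (connector \<alpha> \<gamma> m b * head_sum \<alpha> \<gamma> [] b)) \<le>
        K * L * (connector (Re \<alpha>) (Re \<gamma>) m b * head_sum (Re \<alpha>) (Re \<gamma>) [] b)"
      by (simp add: norm_mult mult_ac del: head_sum.simps)
  qed
  show "(\<lambda>b. connector \<alpha> \<gamma> m b * head_sum \<alpha> \<gamma> [] b) sums
      (gauss_const \<alpha> \<gamma> * (fact m / pochhammer \<alpha> (m + 1)))"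
    using connector_gauss_sums[of \<alpha> \<gamma> m] assms nonpos_Ints_Re
    by (simp add: gauss_const_def mult.commute)
qed

text \<open>Induction on the word. For the empty word the Pochhammer symbols cancel and the terms
  are O(1 / m^2); \<open>False\<close> divides by at least \<alpha>; \<open>True\<close> is handled
  by summation by parts.\<close>

lemma head_sum_last_weight_summable:
  fixes \<alpha> \<gamma> :: real
  assumes "0 < \<alpha>" "0 < \<gamma>"
  shows "summable (\<lambda>m. head_sum \<alpha> \<gamma> v m * (fact m / pochhammer \<alpha> (m + 1)))"
proof (induction v)
  define T where "T m = fact m / pochhammer \<alpha> (m + 1)" for m
  have Tpos: "0 < T m" for m
    using assms by (auto simp: T_def intro!: divide_pos_pos pochhammer_pos)
  note hnn = head_sum_nonneg[OF assms]
  {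
    case Nil
    have eq: "head_sum \<alpha> \<gamma> [] m * (fact m / pochhammer \<alpha> (m + 1)) = 1 / ((real m + \<gamma>) * (real m + \<alpha>))" for m
      using pochhammer_pos[OF assms(1), of m] assms by (simp add: pochhammer_Suc add.commute)
    have "summable (\<lambda>m. inverse (real m ^ 2))"
      by (intro inverse_power_summable) auto
    then show ?case unfolding eq
    proof (rule summable_comparison_test[OF exI[of _ 1], rotated], intro allI impI)
      \<comment> \<open>At m = 0 the majorant is 0 because \<open>inverse 0 = 0\<close>, so the
        comparison starts at 1.\<close>
      fix m :: nat assume "1 \<le> m"
      then have "1 / ((real m + \<gamma>) * (real m + \<alpha>)) \<le> 1 / (real m * real m)"
        using assms by (intro divide_left_mono mult_mono mult_pos_pos) auto
      then show "norm (1 / ((real m + \<gamma>) * (real m + \<alpha>))) \<le> inverse (real m ^ 2)"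
        using assms by (simp add: power2_eq_square divide_simps)
    qed
  next
    case (Cons c v)
    have IH: "summable (\<lambda>m. head_sum \<alpha> \<gamma> v m * T m)" using Cons by (simp add: T_def)
    have "summable (\<lambda>m. head_sum \<alpha> \<gamma> (c # v) m * T m)"
    proof (cases c)
      case False
      show ?thesis
      proof (rule summable_comparison_test[OF exI[of _ 0] summable_mult[OF IH, of "1 / \<alpha>"]], intro allI impI)
        fix m
        have "head_sum \<alpha> \<gamma> v m * T m / (real m + \<alpha>) \<le> head_sum \<alpha> \<gamma> v m * T m / \<alpha>"
          using assms hnn[of v m] Tpos[of m] by (intro divide_left_mono mult_nonneg_nonneg) auto
        then show "norm (head_sum \<alpha> \<gamma> (c # v) m * T m) \<le> 1 / \<alpha> * (head_sum \<alpha> \<gamma> v m * T m)"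
          using False assms hnn[of v m] Tpos[of m] by (simp add: abs_mult)
      qed
    next
      case True
      define P where "P m = (\<Sum>k<m. head_sum \<alpha> \<gamma> v k)" for m
      define a where "a m = P m / (real m + \<gamma>) * T m" for m
      have Pnn: "0 \<le> P m" for m unfolding P_def by (intro sum_nonneg hnn)
      have ann: "0 \<le> a m" for m
        using Pnn[of m] Tpos[of m] assms by (auto simp: a_def)
      have Trec: "T m = T (Suc m) * (1 + \<alpha> / real (Suc m))" for m
      proof -
        have p: "0 < pochhammer \<alpha> (m + 1)" "0 < \<alpha> + real (Suc m)" using assms by (auto intro: pochhammer_pos)
        have *: "f / p = N * f / (p * (\<alpha> + N)) * (1 + \<alpha> / N)" if "0 < p" "0 < N" "0 < \<alpha> + N" for f p N :: real
        proof -
          have "1 + \<alpha> / N = (\<alpha> + N) / N" using that by (simp add: field_simps)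
          then show ?thesis using that by simp
        qed
        have "T (Suc m) = real (Suc m) * fact m / (pochhammer \<alpha> (m + 1) * (\<alpha> + real (Suc m)))"
          by (simp add: T_def pochhammer_Suc)
        then show ?thesis using *[OF p(1) _ p(2)] by (simp add: T_def)
      qed
      \<comment> \<open>The exact decrement is
        \<open>T m - T (Suc m) = \<alpha> * T (Suc m) / real (Suc m)\<close>; enlarging the
        denominator by \<gamma> gives the weight that occurs in \<open>a\<close>.\<close>
      have Tdiff: "T (Suc m) / (real (Suc m) + \<gamma>) + T (Suc m) / \<alpha> \<le> T m / \<alpha>" for m
      proof -
        have "T (Suc m) / (real (Suc m) + \<gamma>) \<le> T (Suc m) / real (Suc m)"
          using Tpos[of "Suc m"] assms by (intro divide_left_mono) auto
        also have "\<dots> = T (Suc m) * (1 + \<alpha> / real (Suc m)) / \<alpha> - T (Suc m) / \<alpha>"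
          using assms by (simp add: field_simps del: of_nat_Suc)
        finally show ?thesis unfolding Trec[of m] by simp
      qed
      \<comment> \<open>summation by parts against \<open>T\<close>, whose decrements dominate the weights of \<open>P\<close> in \<open>a\<close>\<close>
      have inv: "(\<Sum>m<Suc N. a m) + T N / \<alpha> * P N \<le> (\<Sum>k<N. head_sum \<alpha> \<gamma> v k * T k) / \<alpha>" for N
      proof (induction N)
        case 0
        then show ?case by (simp add: a_def P_def)
      next
        case (Suc N)
        have "a (Suc N) + T (Suc N) / \<alpha> * P (Suc N) =
            (T (Suc N) / (real (Suc N) + \<gamma>) + T (Suc N) / \<alpha>) * P (Suc N)"
          by (simp add: a_def algebra_simps)
        also have "\<dots> \<le> T N / \<alpha> * P (Suc N)"
          by (intro mult_right_mono Tdiff Pnn)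
        also have "\<dots> = T N / \<alpha> * P N + head_sum \<alpha> \<gamma> v N * T N / \<alpha>"
          by (simp add: P_def algebra_simps add_divide_distrib)
        finally show ?case using Suc.IH by (simp add: add_divide_distrib)
      qed
      have "(\<Sum>m<N. a m) \<le> suminf (\<lambda>m. head_sum \<alpha> \<gamma> v m * T m) / \<alpha>" for N
      proof -
        have "(\<Sum>m<N. a m) \<le> (\<Sum>m<Suc N. a m) + T N / \<alpha> * P N"
          using ann[of N] Tpos[of N] Pnn[of N] assms by simp
        also note inv[of N]
        also have "(\<Sum>k<N. head_sum \<alpha> \<gamma> v k * T k) / \<alpha> \<le> suminf (\<lambda>m. head_sum \<alpha> \<gamma> v m * T m) / \<alpha>"
          using assms hnn Tpos by (intro divide_right_mono sum_le_suminf IH) (auto intro!: mult_nonneg_nonneg less_imp_le[OF Tpos] hnn)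
        finally show ?thesis .
      qed
      then have "summable a" by (rule summableI_nonneg_bounded[OF ann])
      then show ?thesis using True by (simp add: a_def[abs_def] P_def)
    qed
    then show ?case by (simp add: T_def)
  }
qed

text \<open>The triple sum runs over n < b. Summing over b first produces \<open>H\<close>, summing
  over n first a finite sum; for nonnegative terms either iterated sum converges exactly when the
  triple sum does.\<close>

lemma triple_summable_iff:
  fixes f g :: "nat \<Rightarrow> real" and h H :: "nat \<Rightarrow> nat \<Rightarrow> real"
  assumes nonneg: "\<And>m. 0 \<le> f m" "\<And>n. 0 \<le> g n" "\<And>m b. 0 \<le> h m b"
    and h: "\<And>m n. (h m has_sum H m n) {n<..}"
  shows "(\<lambda>((m, n), b). f m * g n * h m b) summable_on (SIGMA p:UNIV. {snd p<..}) \<longleftrightarrow>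
      (\<lambda>(m, n). f m * H m n * g n) summable_on UNIV" (is "?T \<longleftrightarrow> ?A")
    and "(\<lambda>((m, n), b). f m * g n * h m b) summable_on (SIGMA p:UNIV. {snd p<..}) \<longleftrightarrow>
      (\<lambda>(m, b). f m * h m b * (\<Sum>n<b. g n)) summable_on UNIV" (is "?T \<longleftrightarrow> ?B")
proof -
  have hs: "((\<lambda>b. (\<lambda>((m, n), b). f m * g n * h m b) (p, b)) has_sum
      (\<lambda>(m, n). f m * H m n * g n) p) {snd p<..}" for p
    using has_sum_cmult_right[OF h[of "fst p" "snd p"], of "f (fst p) * g (snd p)"]
    by (simp add: case_prod_unfold mult_ac)
  have hs': "((\<lambda>n. (\<lambda>((m, b), n). f m * g n * h m b) (p, n)) has_sum
      (\<lambda>(m, b). f m * h m b * (\<Sum>n<b. g n)) p) {..<snd p}" for p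
    using has_sum_finite[of "{..<snd p}" "\<lambda>n. f (fst p) * g n * h (fst p) (snd p)"]
    by (simp add: case_prod_unfold sum_distrib_left mult_ac)
  show "?T \<longleftrightarrow> ?A"
  proof
    assume ?T
    then have "(\<lambda>p. infsum (\<lambda>b. (\<lambda>((m, n), b). f m * g n * h m b) (p, b)) {snd p<..}) summable_on UNIV"
      by (intro summable_on_Sigma_banach) (simp add: case_prod_unfold)
    then show ?A unfolding infsumI[OF hs] .
  next
    assume ?A
    then show ?T by (rule summable_on_SigmaI[OF hs]) (auto intro!: mult_nonneg_nonneg nonneg)
  qed
  have "?T \<longleftrightarrow> (\<lambda>((m, b), n). f m * g n * h m b) summable_on (SIGMA p:UNIV. {..<snd p})"
    by (rule summable_on_reindex_bij_witness[where i = "\<lambda>((m, n), b). ((m, b), n)" and j = "\<lambda>((m, n), b). ((m, b), n)"])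
       auto
  also have "\<dots> \<longleftrightarrow> ?B"
  proof
    assume "(\<lambda>((m, b), n). f m * g n * h m b) summable_on (SIGMA p:UNIV. {..<snd p})"
    then have "(\<lambda>p. infsum (\<lambda>n. (\<lambda>((m, b), n). f m * g n * h m b) (p, n)) {..<snd p}) summable_on UNIV"
      by (intro summable_on_Sigma_banach) (simp add: case_prod_unfold)
    then show ?B unfolding infsumI[OF hs'] .
  next
    assume ?B
    then show "(\<lambda>((m, b), n). f m * g n * h m b) summable_on (SIGMA p:UNIV. {..<snd p})"
      by (rule summable_on_SigmaI[OF hs']) (auto intro!: mult_nonneg_nonneg nonneg)
  qed
  finally show "?T \<longleftrightarrow> ?B" .
qed

text \<open>Fubini for the same triple sum, with b summed first on the left and n first on the
  right.\<close>

lemma triple_infsum_eq: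
  fixes f g :: "nat \<Rightarrow> 'a::{banach,real_normed_field}"
  assumes h: "\<And>m n. (h m has_sum H m n) {n<..}"
    and sm: "(\<lambda>((m, n), b). f m * g n * h m b) summable_on (SIGMA p:UNIV. {snd p<..})"
  shows "infsum (\<lambda>(m, n). f m * H m n * g n) UNIV = infsum (\<lambda>(m, b). f m * h m b * (\<Sum>n<b. g n)) UNIV"
proof -
  let ?t = "\<lambda>((m, n), b). f m * g n * h m b" and ?t' = "\<lambda>((m, b), n). f m * g n * h m b"
  have inner: "infsum (\<lambda>b. ?t (p, b)) {snd p<..} = (\<lambda>(m, n). f m * H m n * g n) p" for p
    using infsumI[OF has_sum_cmult_right[OF h[of "fst p" "snd p"], of "f (fst p) * g (snd p)"]]
    by (simp add: case_prod_unfold mult_ac)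
  have inner': "infsum (\<lambda>n. ?t' (p, n)) {..<snd p} = (\<lambda>(m, b). f m * h m b * (\<Sum>n<b. g n)) p" for p
    by (simp add: case_prod_unfold sum_distrib_left mult_ac)
  have sm': "?t' summable_on (SIGMA p:UNIV. {..<snd p})"
    using sm by (rule summable_on_reindex_bij_witness[where i = "\<lambda>((m, n), b). ((m, b), n)"
        and j = "\<lambda>((m, n), b). ((m, b), n)", THEN iffD1, rotated 5]) auto
  have "infsum ?t (SIGMA p:UNIV. {snd p<..}) = infsum ?t' (SIGMA p:UNIV. {..<snd p})"
    by (rule infsum_reindex_bij_witness[where i = "\<lambda>((m, n), b). ((m, b), n)" and j = "\<lambda>((m, n), b). ((m, b), n)"])
       auto
  then show ?thesis
    unfolding infsum_Sigma_banach[OF sm, symmetric] infsum_Sigma_banach[OF sm', symmetric]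
      inner inner' .
qed

section \<open>Transport and duality of connected sums\<close>

definition connected_term :: "'a::real_normed_field \<Rightarrow> 'a \<Rightarrow> bool list \<Rightarrow> bool list \<Rightarrow> nat \<times> nat \<Rightarrow> 'a" where
  "connected_term \<alpha> \<gamma> v u = (\<lambda>(m, n). head_sum \<alpha> \<gamma> v m * connector \<alpha> \<gamma> m n * head_sum \<alpha> \<gamma> u n)"

definition connected_sum :: "'a::real_normed_field \<Rightarrow> 'a \<Rightarrow> bool list \<Rightarrow> bool list \<Rightarrow> 'a" where
  "connected_sum \<alpha> \<gamma> v u = infsum (connected_term \<alpha> \<gamma> v u) UNIV"

lemma connected_term_swap: "connected_term \<alpha> \<gamma> v u (prod.swap p) = connected_term \<alpha> \<gamma> u v p"
  by (simp add: connected_term_def case_prod_unfold connector_commute mult_ac)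

lemma connected_sum_commute: "connected_sum \<alpha> \<gamma> v u = connected_sum \<alpha> \<gamma> u v"
  unfolding connected_sum_def
  by (rule infsum_reindex_bij_witness[where i = prod.swap and j = prod.swap]) (auto simp: connected_term_swap)

lemma connected_summable_commute:
  "connected_term \<alpha> \<gamma> v u summable_on UNIV \<longleftrightarrow> connected_term \<alpha> \<gamma> u v summable_on UNIV"
  by (rule summable_on_reindex_bij_witness[where i = prod.swap and j = prod.swap]) (auto simp: connected_term_swap)

lemma connected_term_False:
  "connected_term \<alpha> \<gamma> (False # v) u =
     (\<lambda>(m, n). head_sum \<alpha> \<gamma> v m * (connector \<alpha> \<gamma> m n / (of_nat m + \<alpha>)) * head_sum \<alpha> \<gamma> u n)"
  by (simp add: connected_term_def)

lemma connected_term_True: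
  "connected_term \<alpha> \<gamma> v (True # u) =
     (\<lambda>(m, b). head_sum \<alpha> \<gamma> v m * (connector \<alpha> \<gamma> m b / (of_nat b + \<gamma>)) * (\<Sum>n<b. head_sum \<alpha> \<gamma> u n))"
  by (simp add: connected_term_def)

text \<open>With the two head sums as \<open>f\<close> and \<open>g\<close>, one iterated form of
  the triple sum has \<open>False\<close> on the left word and the other has \<open>True\<close> on
  the right word. The triple sum itself is recorded as a majorant for complex parameters.\<close>

lemma connected_summable_transport_real:
  fixes \<alpha> \<gamma> :: real
  assumes "0 < \<alpha>" "0 < \<gamma>"
  shows "connected_term \<alpha> \<gamma> v (True # u) summable_on UNIV \<longleftrightarrow> connected_term \<alpha> \<gamma> (False # v) u summable_on UNIV"
    and "connected_term \<alpha> \<gamma> (False # v) u summable_on UNIV \<longleftrightarrow>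
      (\<lambda>((m, n), b). head_sum \<alpha> \<gamma> v m * head_sum \<alpha> \<gamma> u n * (connector \<alpha> \<gamma> m b / (of_nat b + \<gamma>)))
        summable_on (SIGMA p:UNIV. {snd p<..})"
proof -
  have nn: "0 \<le> connector \<alpha> \<gamma> m b / (of_nat b + \<gamma>)" for m b
    using connector_nonneg[OF assms, of m b] assms by auto
  note * = triple_summable_iff[of "head_sum \<alpha> \<gamma> v" "head_sum \<alpha> \<gamma> u"
      "\<lambda>m b. connector \<alpha> \<gamma> m b / (of_nat b + \<gamma>)", OF head_sum_nonneg[OF assms] head_sum_nonneg[OF assms] nn connector_has_sum_real[OF assms]]
  show "connected_term \<alpha> \<gamma> v (True # u) summable_on UNIV \<longleftrightarrow> connected_term \<alpha> \<gamma> (False # v) u summable_on UNIV"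
    unfolding connected_term_True connected_term_False using * by blast
  show "connected_term \<alpha> \<gamma> (False # v) u summable_on UNIV \<longleftrightarrow>
      (\<lambda>((m, n), b). head_sum \<alpha> \<gamma> v m * head_sum \<alpha> \<gamma> u n * (connector \<alpha> \<gamma> m b / (of_nat b + \<gamma>)))
        summable_on (SIGMA p:UNIV. {snd p<..})"
    unfolding connected_term_False using * by blast
qed

text \<open>The letters of \<open>u\<close> are carried over to \<open>v\<close>, each negated,
  until \<open>u\<close> is empty. Gauss's theorem then sums over the second variable and leaves the
  series of \<open>head_sum_last_weight_summable\<close>.\<close>

lemma connected_summable_real:
  fixes \<alpha> \<gamma> :: real
  assumes "0 < \<alpha>" "0 < \<gamma>"
  shows "connected_term \<alpha> \<gamma> v u summable_on UNIV"
proof (induction u arbitrary: v)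
  case Nil
  have hs: "((\<lambda>b. connected_term \<alpha> \<gamma> v [] (m, b)) has_sum
      head_sum \<alpha> \<gamma> v m * (gauss_const \<alpha> \<gamma> * (fact m / pochhammer \<alpha> (m + 1)))) UNIV" for m
    unfolding connected_term_def prod.case mult.assoc
    by (rule has_sum_cmult_right[OF gauss_has_sum_real[OF assms]])
  have "(\<lambda>m. head_sum \<alpha> \<gamma> v m * (gauss_const \<alpha> \<gamma> * (fact m / pochhammer \<alpha> (m + 1)))) summable_on UNIV"
  proof (rule summable_nonneg_imp_summable_on)
    show "summable (\<lambda>m. head_sum \<alpha> \<gamma> v m * (gauss_const \<alpha> \<gamma> * (fact m / pochhammer \<alpha> (m + 1))))"
      using summable_mult[OF head_sum_last_weight_summable[OF assms], of "gauss_const \<alpha> \<gamma>" v] by (simp add: mult_ac)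
    show "0 \<le> head_sum \<alpha> \<gamma> v m * (gauss_const \<alpha> \<gamma> * (fact m / pochhammer \<alpha> (m + 1)))" for m
      using hs[of m] by (rule has_sum_nonneg)
        (auto simp: connected_term_def simp del: head_sum.simps
          intro!: mult_nonneg_nonneg head_sum_nonneg connector_nonneg assms)
  qed
  then have "connected_term \<alpha> \<gamma> v [] summable_on UNIV \<times> UNIV"
    by (rule summable_on_SigmaI[OF hs])
       (auto simp: connected_term_def simp del: head_sum.simps
          intro!: mult_nonneg_nonneg head_sum_nonneg connector_nonneg assms)
  then show ?case by simp
next
  case (Cons c u)
  note transport = connected_summable_transport_real(1)[OF assms]
  show ?case
    using Cons[of "False # v"] Cons[of "True # v"] transport[of v u] transport[of u v]
      connected_summable_commute[of \<alpha> \<gamma> v "False # u"] connected_summable_commute[of \<alpha> \<gamma> "True # v" u]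
    by (cases c) auto
qed

lemma connected_summable:
  assumes "0 < Re \<alpha>" "0 < Re \<gamma>"
  shows "connected_term \<alpha> \<gamma> v u summable_on UNIV"
proof (rule abs_summable_summable)
  obtain K where K: "0 < K" "\<And>m n. norm (connector \<alpha> \<gamma> m n) \<le> K * connector (Re \<alpha>) (Re \<gamma>) m n"
    using norm_connector_le[OF assms] by blast
  obtain L where L: "0 < L" "\<And>v m. norm (head_sum \<alpha> \<gamma> v m) \<le> L * head_sum (Re \<alpha>) (Re \<gamma>) v m"
    using norm_head_sum_le[OF assms] by blast
  have "(\<lambda>p. L * K * L * connected_term (Re \<alpha>) (Re \<gamma>) v u p) summable_on UNIV"
    by (intro summable_on_cmult_right connected_summable_real assms)
  then show "(\<lambda>p. norm (connected_term \<alpha> \<gamma> v u p)) summable_on UNIV"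
  proof (rule Infinite_Sum.abs_summable_on_comparison_test')
    fix p :: "nat \<times> nat"
    obtain m n where p: "p = (m, n)" by (cases p)
    have "norm (head_sum \<alpha> \<gamma> v m) * norm (connector \<alpha> \<gamma> m n) * norm (head_sum \<alpha> \<gamma> u n) \<le>
      (L * head_sum (Re \<alpha>) (Re \<gamma>) v m) * (K * connector (Re \<alpha>) (Re \<gamma>) m n) * (L * head_sum (Re \<alpha>) (Re \<gamma>) u n)"
      using K(1) L(1)
      by (intro mult_mono K(2) L(2) mult_nonneg_nonneg connector_nonneg head_sum_nonneg assms) auto
    then show "norm (connected_term \<alpha> \<gamma> v u p) \<le> L * K * L * connected_term (Re \<alpha>) (Re \<gamma>) v u p"
      by (simp add: p connected_term_def norm_mult mult_ac)
  qed
qed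

text \<open>Both sides are iterated sums of one triple sum, whose absolute convergence follows from
  the real case through the norm bounds.\<close>

lemma connected_sum_transport:
  assumes "0 < Re \<alpha>" "0 < Re \<gamma>"
  shows "connected_sum \<alpha> \<gamma> (False # v) u = connected_sum \<alpha> \<gamma> v (True # u)"
  unfolding connected_sum_def connected_term_True connected_term_False
proof (rule triple_infsum_eq[OF connector_has_sum[OF assms]], rule abs_summable_summable)
  obtain K where K: "0 < K" "\<And>m b. norm (connector \<alpha> \<gamma> m b / (of_nat b + \<gamma>)) \<le>
      K * (connector (Re \<alpha>) (Re \<gamma>) m b / (of_nat b + Re \<gamma>))"
    using norm_connector_divide_le[OF assms] by blast
  obtain L where L: "0 < L" "\<And>v m. norm (head_sum \<alpha> \<gamma> v m) \<le> L * head_sum (Re \<alpha>) (Re \<gamma>) v m"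
    using norm_head_sum_le[OF assms] by blast
  define t where "t = (\<lambda>((m, n), b). head_sum (Re \<alpha>) (Re \<gamma>) v m * head_sum (Re \<alpha>) (Re \<gamma>) u n *
      (connector (Re \<alpha>) (Re \<gamma>) m b / (of_nat b + Re \<gamma>)))"
  have "t summable_on (SIGMA p:UNIV. {snd p<..})"
    using connected_summable_real[OF assms, of "False # v" u]
      connected_summable_transport_real(2)[OF assms] by (simp add: t_def)
  then have "(\<lambda>x. L * L * K * t x) summable_on (SIGMA p:UNIV. {snd p<..})"
    by (rule summable_on_cmult_right)
  then show "(\<lambda>x. norm ((\<lambda>((m, n), b). head_sum \<alpha> \<gamma> v m * head_sum \<alpha> \<gamma> u n *
      (connector \<alpha> \<gamma> m b / (of_nat b + \<gamma>))) x)) summable_on (SIGMA p:UNIV. {snd p<..})"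
  proof (rule Infinite_Sum.abs_summable_on_comparison_test')
    fix x :: "(nat \<times> nat) \<times> nat"
    obtain m n b where x: "x = ((m, n), b)" by (metis surj_pair)
    have "norm (head_sum \<alpha> \<gamma> v m) * norm (head_sum \<alpha> \<gamma> u n) * norm (connector \<alpha> \<gamma> m b / (of_nat b + \<gamma>)) \<le>
      (L * head_sum (Re \<alpha>) (Re \<gamma>) v m) * (L * head_sum (Re \<alpha>) (Re \<gamma>) u n) *
      (K * (connector (Re \<alpha>) (Re \<gamma>) m b / (of_nat b + Re \<gamma>)))"
      using K(1) L(1)
      by (intro mult_mono K(2) L(2) mult_nonneg_nonneg head_sum_nonneg assms) auto
    then show "norm ((\<lambda>((m, n), b). head_sum \<alpha> \<gamma> v m * head_sum \<alpha> \<gamma> u n *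
      (connector \<alpha> \<gamma> m b / (of_nat b + \<gamma>))) x) \<le> L * L * K * t x"
      by (simp only: x t_def prod.case norm_mult mult_ac)
  qed
qed

text \<open>Each transport removes the first letter of the left word and puts its negation in front
  of the right word, so the left word arrives reversed.\<close>

lemma connected_sum_append:
  assumes "0 < Re \<alpha>" "0 < Re \<gamma>"
  shows "connected_sum \<alpha> \<gamma> v u = connected_sum \<alpha> \<gamma> [] (rev (map Not v) @ u)"
proof (induction v arbitrary: u)
  case (Cons c v)
  \<comment> \<open>A letter \<open>True\<close> moves by the transport read backwards, with the two
    words exchanged by symmetry.\<close>
  have "connected_sum \<alpha> \<gamma> (c # v) u = connected_sum \<alpha> \<gamma> v ((\<not> c) # u)"
    using connected_sum_transport[OF assms, of v u] connected_sum_transport[OF assms, of u v]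
      connected_sum_commute[of \<alpha> \<gamma> v "False # u"] connected_sum_commute[of \<alpha> \<gamma> "True # v" u]
    by (cases c) auto
  then show ?case using Cons by simp
qed simp

lemma connected_sum_dual:
  assumes "0 < Re \<alpha>" "0 < Re \<gamma>"
  shows "connected_sum \<alpha> \<gamma> v [] = connected_sum \<alpha> \<gamma> (rev (map Not v)) []"
  using connected_sum_append[OF assms, of v "[]"] by (simp add: connected_sum_commute)

text \<open>Gauss's theorem sums the connected sum with \<open>[]\<close> over its second variable,
  turning the connector into \<open>gauss_const \<alpha> \<gamma>\<close> times the weight of the
  last variable.\<close>

lemma head_sum_last_weight_has_sum:
  assumes "0 < Re \<alpha>" "0 < Re \<gamma>"
  shows "((\<lambda>m. head_sum \<alpha> \<gamma> v m * (fact m / pochhammer \<alpha> (m + 1))) has_sum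
    (connected_sum \<alpha> \<gamma> v [] / gauss_const \<alpha> \<gamma>)) UNIV"
proof -
  let ?c = "gauss_const \<alpha> \<gamma>"
  have hs: "((\<lambda>b. connected_term \<alpha> \<gamma> v [] (m, b)) has_sum
      head_sum \<alpha> \<gamma> v m * (?c * (fact m / pochhammer \<alpha> (m + 1)))) UNIV" for m
    unfolding connected_term_def prod.case mult.assoc
    by (rule has_sum_cmult_right[OF gauss_has_sum[OF assms]])
  have "(connected_term \<alpha> \<gamma> v [] has_sum connected_sum \<alpha> \<gamma> v []) (UNIV \<times> UNIV)"
    using connected_summable[OF assms, of v "[]"] by (simp add: connected_sum_def)
  then have "((\<lambda>m. head_sum \<alpha> \<gamma> v m * (?c * (fact m / pochhammer \<alpha> (m + 1)))) has_sum
      connected_sum \<alpha> \<gamma> v []) UNIV"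
    by (rule has_sum_SigmaD) (rule hs)
  then have "((\<lambda>m. 1 / ?c * (head_sum \<alpha> \<gamma> v m * (?c * (fact m / pochhammer \<alpha> (m + 1))))) has_sum
      1 / ?c * connected_sum \<alpha> \<gamma> v []) UNIV"
    by (rule has_sum_cmult_right)
  then show ?thesis using gauss_const_nonzero[OF assms] by (simp add: mult_ac)
qed

section \<open>Generating functions\<close>

text \<open>The coefficient of \<open>x ^ l\<close> in \<open>head_sum \<alpha> (\<alpha> - x) v m\<close>.\<close>
primrec head_coeff :: "'a::real_normed_field \<Rightarrow> bool list \<Rightarrow> nat \<Rightarrow> nat \<Rightarrow> 'a" where
  "head_coeff \<alpha> [] l m = pochhammer \<alpha> m / fact m / (of_nat m + \<alpha>) ^ Suc l"
| "head_coeff \<alpha> (c # v) l m =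
     (if c then (\<Sum>j\<le>l. (\<Sum>k<m. head_coeff \<alpha> v (l - j) k) / (of_nat m + \<alpha>) ^ Suc j)
      else head_coeff \<alpha> v l m / (of_nat m + \<alpha>))"

lemma head_coeff_nonneg: "0 < \<alpha> \<Longrightarrow> 0 \<le> head_coeff \<alpha> v l m" for \<alpha> :: real
  by (induction v arbitrary: l m)
     (auto intro!: divide_nonneg_nonneg mult_nonneg_nonneg sum_nonneg pochhammer_nonneg)

lemma norm_head_coeff_le:
  assumes "0 < Re \<alpha>"
  obtains K where "0 < K" "\<And>v l m. norm (head_coeff \<alpha> v l m) \<le> K * head_coeff (Re \<alpha>) v l m"
proof -
  obtain K where K: "0 < K" "\<And>n. norm (pochhammer \<alpha> n) \<le> K * pochhammer (Re \<alpha>) n"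
    using norm_pochhammer_le[OF assms] by blast
  have pow: "(real m + Re \<alpha>) ^ j \<le> norm (of_nat m + \<alpha>) ^ j" for m j
    using assms Re_add_of_nat_le_norm by (intro power_mono) auto
  have pos: "0 < (real m + Re \<alpha>) ^ j" for m j using assms by (intro zero_less_power) auto
  have "norm (head_coeff \<alpha> v l m) \<le> K * head_coeff (Re \<alpha>) v l m" for v l m
  proof (induction v arbitrary: l m)
    case Nil
    have "norm (head_coeff \<alpha> [] l m) \<le> K * pochhammer (Re \<alpha>) m / fact m / (of_nat m + Re \<alpha>) ^ Suc l"
      unfolding head_coeff.simps norm_divide norm_power
      using K assms pow[of m "Suc l"] pos[of m "Suc l"]
      by (intro frac_le) (auto intro!: mult_nonneg_nonneg divide_nonneg_nonneg divide_right_mono pochhammer_nonneg)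
    then show ?case by simp
  next
    case (Cons c v)
    have nn: "0 \<le> head_coeff (Re \<alpha>) v l m" for l m using head_coeff_nonneg[OF assms] .
    show ?case
    proof (cases c)
      case True
      have "norm ((\<Sum>k<m. head_coeff \<alpha> v (l - j) k) / (of_nat m + \<alpha>) ^ Suc j) \<le>
          (\<Sum>k<m. K * head_coeff (Re \<alpha>) v (l - j) k) / (of_nat m + Re \<alpha>) ^ Suc j" for j
        unfolding norm_divide norm_power
        using K nn pow[of m "Suc j"] pos[of m "Suc j"]
        by (intro frac_le order.trans[OF norm_sum] sum_mono Cons.IH) (auto intro!: sum_nonneg mult_nonneg_nonneg)
      then have "norm (\<Sum>j\<le>l. (\<Sum>k<m. head_coeff \<alpha> v (l - j) k) / (of_nat m + \<alpha>) ^ Suc j) \<le>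
          (\<Sum>j\<le>l. (\<Sum>k<m. K * head_coeff (Re \<alpha>) v (l - j) k) / (of_nat m + Re \<alpha>) ^ Suc j)"
        by (intro order.trans[OF norm_sum] sum_mono)
      also have "\<dots> = K * head_coeff (Re \<alpha>) (c # v) l m"
        using True by (simp only: head_coeff.simps if_True sum_distrib_left times_divide_eq_right)
      finally show ?thesis using True by simp
    next
      case False
      have "norm (head_coeff \<alpha> v l m) / norm (of_nat m + \<alpha>) \<le>
          (K * head_coeff (Re \<alpha>) v l m) / (of_nat m + Re \<alpha>)"
        using assms K nn Re_add_of_nat_le_norm Cons.IH by (intro frac_le) (auto intro!: mult_nonneg_nonneg)
      then show ?thesis using False by (simp add: norm_divide)
    qed
  qed
  with K(1) show ?thesis using that by blast
qed

text \<open>With M = m + \<alpha> this expands the factor 1 / (m + \<gamma>), where \<gamma> =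
  \<alpha> - x.\<close>

lemma geometric_sums_divide:
  fixes x M :: "'a::{banach,real_normed_field}"
  assumes "norm x < norm M"
  shows "summable (\<lambda>j. norm (x ^ j / M ^ Suc j))" "(\<lambda>j. x ^ j / M ^ Suc j) sums (1 / (M - x))"
proof -
  have M: "M \<noteq> 0" "M - x \<noteq> 0" using assms by auto
  have lt: "norm (x / M) < 1" using assms M by (simp add: norm_divide)
  have eq: "x ^ j / M ^ Suc j = 1 / M * (x / M) ^ j" for j by (simp add: power_divide)
  have "(\<lambda>j. 1 / M * (x / M) ^ j) sums (1 / M * (1 / (1 - x / M)))"
    by (intro sums_mult geometric_sums lt)
  moreover have "1 / M * (1 / (1 - x / M)) = 1 / (M - x)" using M by (simp add: field_simps)
  ultimately show "(\<lambda>j. x ^ j / M ^ Suc j) sums (1 / (M - x))" unfolding eq by simp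
  show "summable (\<lambda>j. norm (x ^ j / M ^ Suc j))"
    unfolding eq norm_mult norm_power using lt by (intro summable_mult summable_geometric) auto
qed

text \<open>Each \<open>True\<close> multiplies the inner series by a geometric series. The Cauchy
  product needs absolute convergence, which is therefore carried along in the induction.\<close>

lemma head_coeff_sums:
  fixes \<alpha> x :: "'a::{banach,real_normed_field}"
  assumes x: "\<And>m. norm x < norm (of_nat m + \<alpha>)"
  shows "summable (\<lambda>l. norm (head_coeff \<alpha> v l m * x ^ l)) \<and>
    (\<lambda>l. head_coeff \<alpha> v l m * x ^ l) sums head_sum \<alpha> (\<alpha> - x) v m"
proof (induction v arbitrary: m)
  case Nil
  let ?w = "pochhammer \<alpha> m / fact m"
  have eq: "head_coeff \<alpha> [] l m * x ^ l = ?w * (x ^ l / (of_nat m + \<alpha>) ^ Suc l)" for l by simp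
  have "summable (\<lambda>l. norm (?w * (x ^ l / (of_nat m + \<alpha>) ^ Suc l)))"
    unfolding norm_mult[of ?w] by (intro summable_mult geometric_sums_divide(1) x)
  moreover have "head_sum \<alpha> (\<alpha> - x) [] m = ?w * (1 / (of_nat m + \<alpha> - x))"
    by (simp add: algebra_simps)
  moreover have "(\<lambda>l. ?w * (x ^ l / (of_nat m + \<alpha>) ^ Suc l)) sums (?w * (1 / (of_nat m + \<alpha> - x)))"
    by (intro sums_mult geometric_sums_divide(2) x)
  ultimately show ?case unfolding eq by (simp only: simp_thms)
next
  case (Cons c v)
  show ?case
  proof (cases c)
    case False
    have eq: "head_coeff \<alpha> (c # v) l m * x ^ l = head_coeff \<alpha> v l m * x ^ l / (of_nat m + \<alpha>)" for l
      using False by simp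
    show ?thesis unfolding eq norm_divide using False Cons[of m] by (auto intro: summable_divide sums_divide)
  next
    case True
    define g where "g j = x ^ j / (of_nat m + \<alpha>) ^ Suc j" for j
    define p where "p l = (\<Sum>k<m. head_coeff \<alpha> v l k * x ^ l)" for l
    have g: "summable (\<lambda>j. norm (g j))" "g sums (1 / (of_nat m + \<alpha> - x))"
      unfolding g_def[abs_def] by (rule geometric_sums_divide[OF x])+
    have "summable (\<lambda>l. \<Sum>k<m. norm (head_coeff \<alpha> v l k * x ^ l))"
      using Cons by (intro summable_sum) auto
    then have p1: "summable (\<lambda>l. norm (p l))"
      by (rule summable_comparison_test[OF exI, rotated]) (auto simp: p_def intro: norm_sum)
    have p2: "p sums (\<Sum>k<m. head_sum \<alpha> (\<alpha> - x) v k)"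
      unfolding p_def[abs_def] using Cons by (intro sums_sum) auto
    have eq: "head_coeff \<alpha> (c # v) l m * x ^ l = (\<Sum>j\<le>l. g j * p (l - j))" for l
    proof -
      have "(\<Sum>k<m. head_coeff \<alpha> v (l - j) k) / (of_nat m + \<alpha>) ^ Suc j * x ^ l = g j * p (l - j)"
        if "j \<le> l" for j
      proof -
        have "x ^ l = x ^ j * x ^ (l - j)" using that by (simp flip: power_add)
        then show ?thesis by (simp add: g_def p_def sum_distrib_right[symmetric])
      qed
      then show ?thesis using True by (simp add: sum_distrib_right)
    qed
    have "summable (\<lambda>l. \<Sum>j\<le>l. norm (g j) * norm (p (l - j)))"
      using g(1) p1 by (intro summable_Cauchy_product) auto
    then have "summable (\<lambda>l. norm (head_coeff \<alpha> (c # v) l m * x ^ l))" unfolding eq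
      by (rule summable_comparison_test[OF exI, rotated])
         (auto simp flip: norm_mult intro: norm_sum)
    moreover have "(\<lambda>l. head_coeff \<alpha> (c # v) l m * x ^ l) sums head_sum \<alpha> (\<alpha> - x) (c # v) m"
      using Cauchy_product_sums[OF g(1) p1] g(2) p2 True
      unfolding eq by (simp add: sums_iff algebra_simps)
    ultimately show ?thesis by blast
  qed
qed

lemma head_coeff_has_sum_real:
  fixes \<alpha> x :: real
  assumes "0 \<le> x" "x < \<alpha>"
  shows "((\<lambda>l. head_coeff \<alpha> v l m * x ^ l) has_sum head_sum \<alpha> (\<alpha> - x) v m) UNIV"
  using assms head_coeff_sums[of x \<alpha> v m] head_coeff_nonneg[of \<alpha> v]
  by (intro sums_nonneg_imp_has_sum) (auto intro!: mult_nonneg_nonneg)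

lemma head_coeff_has_sum:
  assumes "0 \<le> x" "x < Re \<alpha>"
  shows "((\<lambda>l. head_coeff \<alpha> v l m * of_real x ^ l) has_sum head_sum \<alpha> (\<alpha> - of_real x) v m) UNIV"
proof -
  have "norm (complex_of_real x) < norm (of_nat m + \<alpha>)" for m
    using assms Re_add_of_nat_le_norm[of m \<alpha>] by simp
  from head_coeff_sums[OF this] show ?thesis by (intro norm_summable_imp_has_sum) auto
qed

section \<open>Generating series with the weight of the last variable\<close>

text \<open>Compared with \<open>fact m / pochhammer \<alpha> m\<close> this contains one extra
  factor 1 / (m + \<alpha>), which accounts for one letter \<open>False\<close>.\<close>

definition last_weight :: "'a::real_normed_field \<Rightarrow> nat \<Rightarrow> 'a" where
  "last_weight \<alpha> m = fact m / pochhammer \<alpha> (m + 1)"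

lemma last_weight_nonneg: "0 < \<alpha> \<Longrightarrow> 0 \<le> last_weight \<alpha> m" for \<alpha> :: real
  unfolding last_weight_def by (intro divide_nonneg_nonneg pochhammer_nonneg) auto

lemma norm_last_weight_le:
  assumes "0 < Re \<alpha>"
  shows "norm (last_weight \<alpha> m) \<le> last_weight (Re \<alpha>) m"
  unfolding last_weight_def norm_divide norm_fact
  using assms by (intro divide_left_mono pochhammer_Re_le_norm mult_pos_pos pochhammer_pos)
    (auto simp: pochhammer_nonzero nonpos_Ints_Re)

lemma norm_head_coeff_last_weight_le:
  assumes "0 < Re \<alpha>"
  obtains K where "0 < K"
    "\<And>v l m. norm (head_coeff \<alpha> v l m * last_weight \<alpha> m) \<le> K * (head_coeff (Re \<alpha>) v l m * last_weight (Re \<alpha>) m)"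
proof -
  obtain K where K: "0 < K" "\<And>v l m. norm (head_coeff \<alpha> v l m) \<le> K * head_coeff (Re \<alpha>) v l m"
    using norm_head_coeff_le[OF assms] by blast
  have "norm (head_coeff \<alpha> v l m * last_weight \<alpha> m) \<le> K * head_coeff (Re \<alpha>) v l m * last_weight (Re \<alpha>) m" for v l m
    unfolding norm_mult using K(1)
    by (intro mult_mono K(2) norm_last_weight_le mult_nonneg_nonneg head_coeff_nonneg assms) auto
  with K(1) show ?thesis by (intro that[of K]) (auto simp: mult.assoc)
qed

lemma head_coeff_last_weight_pair_summable_real:
  fixes \<alpha> x :: real
  assumes "0 \<le> x" "x < \<alpha>"
  shows "(\<lambda>(m, l). head_coeff \<alpha> v l m * last_weight \<alpha> m * x ^ l) summable_on UNIV \<times> UNIV"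
proof (rule summable_on_SigmaI)
  have pos: "0 < \<alpha>" "0 < \<alpha> - x" using assms by auto
  show "((\<lambda>l. case (m, l) of (m, l) \<Rightarrow> head_coeff \<alpha> v l m * last_weight \<alpha> m * x ^ l) has_sum
      head_sum \<alpha> (\<alpha> - x) v m * last_weight \<alpha> m) UNIV" for m
    using has_sum_cmult_left[OF head_coeff_has_sum_real[OF assms], of v m "last_weight \<alpha> m"]
    by (simp add: mult_ac)
  show "(\<lambda>m. head_sum \<alpha> (\<alpha> - x) v m * last_weight \<alpha> m) summable_on UNIV"
    using head_sum_last_weight_summable[OF pos, of v]
    by (intro summable_nonneg_imp_summable_on mult_nonneg_nonneg head_sum_nonneg last_weight_nonneg pos)
       (simp add: last_weight_def)
  show "0 \<le> (case (m, l) of (m, l) \<Rightarrow> head_coeff \<alpha> v l m * last_weight \<alpha> m * x ^ l)" for m l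
    using assms pos by (auto intro!: mult_nonneg_nonneg head_coeff_nonneg last_weight_nonneg)
qed

lemma head_coeff_last_weight_summable_real:
  fixes \<alpha> :: real
  assumes "0 < \<alpha>"
  shows "(\<lambda>m. head_coeff \<alpha> v l m * last_weight \<alpha> m) summable_on UNIV"
proof -
  \<comment> \<open>Any point strictly between 0 and \<alpha> would do; it must be nonzero so that x
    ^ l can be divided out.\<close>
  define x where "x = \<alpha> / 2"
  have x: "0 < x" "0 \<le> x" "x < \<alpha>" using assms by (auto simp: x_def)
  have "(\<lambda>(l, m). head_coeff \<alpha> v l m * last_weight \<alpha> m * x ^ l) summable_on UNIV \<times> UNIV"
    using head_coeff_last_weight_pair_summable_real[OF x(2,3), of v]
    by (rule summable_on_swap[THEN iffD1, THEN summable_on_cong[THEN iffD1, rotated]]) auto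
  then have "(\<lambda>m. head_coeff \<alpha> v l m * last_weight \<alpha> m * x ^ l) summable_on UNIV"
    by (rule summable_on_SigmaD1) auto
  then have "(\<lambda>m. head_coeff \<alpha> v l m * last_weight \<alpha> m * x ^ l * (1 / x ^ l)) summable_on UNIV"
    by (rule summable_on_cmult_left)
  then show ?thesis using x by simp
qed

text \<open>The double series over m and l converges absolutely. Summing over l first gives the
  weighted \<open>head_sum\<close> and hence the connected sum; summing over m first gives the
  coefficients.\<close>

lemma head_coeff_last_weight_generating_function:
  assumes "0 < x" "x < Re \<alpha>"
  defines "\<gamma> \<equiv> \<alpha> - of_real x"
  assumes coeff: "\<And>l. (\<lambda>m. head_coeff \<alpha> v l m * last_weight \<alpha> m) sums A l"
  shows "(\<lambda>l. A l * of_real x ^ l) sums (connected_sum \<alpha> \<gamma> v [] / gauss_const \<alpha> \<gamma>)"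
proof -
  have pos: "0 < Re \<alpha>" "0 < Re \<gamma>" using assms by auto
  have x: "0 \<le> x" using assms by simp
  obtain K where K: "0 < K"
    "\<And>v l m. norm (head_coeff \<alpha> v l m * last_weight \<alpha> m) \<le> K * (head_coeff (Re \<alpha>) v l m * last_weight (Re \<alpha>) m)"
    using norm_head_coeff_last_weight_le[OF pos(1)] by blast
  define f where "f = (\<lambda>(m, l). head_coeff \<alpha> v l m * last_weight \<alpha> m * of_real x ^ l)"
  have f: "f summable_on UNIV \<times> UNIV"
  proof (rule abs_summable_summable, rule Infinite_Sum.abs_summable_on_comparison_test')
    show "(\<lambda>p. K * (\<lambda>(m, l). head_coeff (Re \<alpha>) v l m * last_weight (Re \<alpha>) m * x ^ l) p) summable_on UNIV \<times> UNIV"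
      by (intro summable_on_cmult_right head_coeff_last_weight_pair_summable_real x assms)
    fix p :: "nat \<times> nat"
    obtain m l where p: "p = (m, l)" by (cases p)
    have "norm (head_coeff \<alpha> v l m * last_weight \<alpha> m) * x ^ l \<le> K * (head_coeff (Re \<alpha>) v l m * last_weight (Re \<alpha>) m) * x ^ l"
      using x by (intro mult_right_mono K) auto
    then show "norm (f p) \<le> K * (\<lambda>(m, l). head_coeff (Re \<alpha>) v l m * last_weight (Re \<alpha>) m * x ^ l) p"
      using x by (simp add: p f_def norm_mult norm_power mult.assoc)
  qed
  have "((\<lambda>l. f (m, l)) has_sum head_sum \<alpha> \<gamma> v m * last_weight \<alpha> m) UNIV" for m
    using has_sum_cmult_left[OF head_coeff_has_sum[OF x assms(2)], of v m "last_weight \<alpha> m"]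
    by (simp add: f_def \<gamma>_def mult_ac)
  then have "(f has_sum (connected_sum \<alpha> \<gamma> v [] / gauss_const \<alpha> \<gamma>)) (UNIV \<times> UNIV)"
    by (rule has_sum_SigmaI[OF _ _ f]) (use head_sum_last_weight_has_sum[OF pos, of v] in \<open>simp add: last_weight_def\<close>)
  then have swapped: "((\<lambda>(l, m). f (m, l)) has_sum (connected_sum \<alpha> \<gamma> v [] / gauss_const \<alpha> \<gamma>)) (UNIV \<times> UNIV)"
    by (rule has_sum_swap[THEN iffD1])
  have "((\<lambda>m. (\<lambda>(l, m). f (m, l)) (l, m)) has_sum A l * of_real x ^ l) UNIV" for l
  proof -
    have "(\<lambda>m. f (m, l)) summable_on UNIV"
      using summable_on_SigmaD1[of "\<lambda>l m. f (m, l)" UNIV "\<lambda>_. UNIV" l] swapped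
      by (auto simp: summable_on_def)
    \<comment> \<open>The slice has some unordered sum \<open>s\<close>; the hypothesis
      \<open>coeff\<close> concerns an ordinary series, and uniqueness of limits identifies the
      two.\<close>
    then obtain s where s: "((\<lambda>m. f (m, l)) has_sum s) UNIV" by (auto simp: summable_on_def)
    have "(\<lambda>m. f (m, l)) sums (A l * of_real x ^ l)"
      using sums_mult2[OF coeff[of l], of "of_real x ^ l"] by (simp add: f_def)
    with s show ?thesis using has_sum_imp_sums[OF s] sums_unique2 by auto
  qed
  then have "((\<lambda>l. A l * of_real x ^ l) has_sum (connected_sum \<alpha> \<gamma> v [] / gauss_const \<alpha> \<gamma>)) UNIV"
    by (intro has_sum_SigmaD[OF swapped]) auto
  then show ?thesis by (rule has_sum_imp_sums)
qed

text \<open>The series is known only at positive real points. Once the coefficients below l vanish,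
  division by x ^ l leaves a series with constant term d l, which continuity at 0 forces to
  vanish.\<close>

lemma powser_coeffs_zero:
  fixes d :: "nat \<Rightarrow> complex"
  assumes "0 < r" and d: "\<And>x. 0 < x \<Longrightarrow> x < r \<Longrightarrow> (\<lambda>l. d l * of_real x ^ l) sums 0"
  shows "d l = 0"
proof (induction l rule: less_induct)
  case (less l)
  define e where "e j = d (j + l)" for j
  have e: "(\<lambda>j. e j * of_real x ^ j) sums 0" if "0 < x" "x < r" for x
  proof -
    have "(\<lambda>j. d (j + l) * of_real x ^ (j + l)) sums (0 - (\<Sum>i<l. d i * of_real x ^ i))"
      using sums_split_initial_segment[OF d[OF that], of l] .
    then have "(\<lambda>j. d (j + l) * of_real x ^ (j + l) / of_real x ^ l) sums (0 / of_real x ^ l)"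
      using less by (intro sums_divide) simp
    then show ?thesis using that by (simp add: e_def power_add)
  qed
  have "isCont (\<lambda>z. \<Sum>j. e j * z ^ j) (0::complex)"
    by (rule isCont_powser[of e "of_real (r / 2)"])
       (use e[of "r / 2"] \<open>0 < r\<close> in \<open>auto simp: sums_iff\<close>)
  \<comment> \<open>The double successor keeps all points strictly below r; a single one would start
    at r itself.\<close>
  moreover have "(\<lambda>n. complex_of_real (r * inverse (real (Suc (Suc n))))) \<longlonglongrightarrow> of_real (r * 0)"
    by (intro tendsto_intros LIMSEQ_Suc[OF LIMSEQ_inverse_real_of_nat])
  ultimately have "(\<lambda>n. \<Sum>j. e j * complex_of_real (r * inverse (real (Suc (Suc n)))) ^ j) \<longlonglongrightarrow> (\<Sum>j. e j * 0 ^ j)"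
    by (intro isCont_tendsto_compose[of 0 "\<lambda>z. \<Sum>j. e j * z ^ j"]) auto
  moreover have "(\<Sum>j. e j * complex_of_real (r * inverse (real (Suc (Suc n)))) ^ j) = 0" for n
  proof -
    have "r * inverse (real (Suc (Suc n))) < r"
      using \<open>0 < r\<close> by (simp add: divide_simps)
    then show ?thesis
      using e[of "r * inverse (real (Suc (Suc n)))"] \<open>0 < r\<close> by (simp add: sums_iff del: of_nat_Suc)
  qed
  ultimately have "(\<Sum>j. e j * 0 ^ j) = 0" by (simp add: LIMSEQ_const_iff)
  then show ?case by (simp add: e_def)
qed

section \<open>Words and indices\<close>

text \<open>The argument is the reversed index, so its head is the last entry.\<close>
fun index_word :: "nat list \<Rightarrow> bool list" where
  "index_word [] = []"
| "index_word [k] = replicate (k - 1) False"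
| "index_word (k # k' # ks) = replicate (k - 1) False @ True # index_word (k' # ks)"

text \<open>An entry k corresponds to y x^(k-1) in the usual word notation, with y as
  \<open>True\<close> and x as \<open>False\<close>. Unlike \<open>index_word\<close>, this keeps
  the letter \<open>True\<close> of the first entry and follows the order of the index.\<close>

definition full_word :: "nat list \<Rightarrow> bool list" where
  "full_word ks = concat (map (\<lambda>k. True # replicate (k - 1) False) ks)"

lemma full_word_simps [simp]:
  "full_word [] = []"
  "full_word (k # ks) = True # replicate (k - 1) False @ full_word ks"
  "full_word (ks @ ks') = full_word ks @ full_word ks'"
  by (simp_all add: full_word_def)

lemma index_word_rev:
  assumes "ks \<noteq> []"
  shows "index_word (rev ks) @ [True] = rev (full_word ks)"
  using assms
proof (induction ks rule: rev_nonempty_induct)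
  case (snoc k ks)
  then obtain k' ks' where "rev ks = k' # ks'" by (cases "rev ks") auto
  with snoc show ?case by simp
qed simp

lemma full_word_replicate_one: "full_word (replicate a (Suc 0)) = replicate a True"
  by (induction a) auto

text \<open>The a ones of a block give a letters \<open>True\<close>; its entry b + 2 gives one more
  \<open>True\<close> and b + 1 letters \<open>False\<close>.\<close>

lemma full_word_of_blocks:
  "full_word (of_blocks bs) = concat (map (\<lambda>(a, b). replicate (Suc a) True @ replicate (Suc b) False) bs)"
  by (induction bs) (auto simp: of_blocks_def full_word_replicate_one replicate_append_same)

text \<open>The a pending ones form a prefix of letters \<open>True\<close>. The condition on the
  last entry ensures that every run of ones is closed by a larger entry, with none pending at the
  end.\<close>

lemma full_word_blocks_aux:
  assumes "\<forall>k\<in>set ks. 1 \<le> k" "if ks = [] then a = 0 else 2 \<le> last ks"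
  shows "replicate a True @ full_word ks =
    concat (map (\<lambda>(a, b). replicate (Suc a) True @ replicate (Suc b) False) (blocks_aux a ks))"
  using assms
proof (induction a ks rule: blocks_aux.induct)
  case (2 a k ks)
  show ?case
  proof (cases "k = 1")
    case True
    with 2(3,4) have "if ks = [] then Suc a = 0 else 2 \<le> last ks" by (auto split: if_splits)
    with 2 True show ?thesis by (simp add: replicate_append_same replicate_app_Cons_same)
  next
    case False
    with 2(3) obtain j where j: "k = Suc (Suc j)" by (cases k; cases "k - 1") auto
    from 2(4) have "if ks = [] then (0::nat) = 0 else 2 \<le> last ks" by (auto split: if_splits)
    with 2 False j show ?thesis by (simp add: replicate_append_same replicate_app_Cons_same)
  qed
qed simp

text \<open>Negated reversal exchanges a and b within a block and reverses the order of the blocks,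
  which is exactly the rule for the dual index.\<close>

lemma rev_map_Not_blocks:
  "rev (map Not (concat (map (\<lambda>(a, b). replicate (Suc a) True @ replicate (Suc b) False) bs))) =
   concat (map (\<lambda>(a, b). replicate (Suc a) True @ replicate (Suc b) False) (rev (map (\<lambda>(a, b). (b, a)) bs)))"
  by (induction bs) (auto simp: replicate_append_same simp flip: replicate_Suc)

lemma full_word_dual:
  assumes "admissible ks"
  shows "full_word (dual_index ks) = rev (map Not (full_word ks))"
proof -
  have "replicate 0 True @ full_word ks =
      concat (map (\<lambda>(a, b). replicate (Suc a) True @ replicate (Suc b) False) (blocks ks))"
    unfolding blocks_def using assms by (intro full_word_blocks_aux) (auto simp: admissible_def)
  then show ?thesis
    unfolding dual_index_def full_word_of_blocks rev_map_Not_blocks[symmetric] by simp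
qed

lemma dual_index_pos: "k \<in> set (dual_index ks) \<Longrightarrow> 1 \<le> k"
  by (auto simp: dual_index_def of_blocks_def)

text \<open>The full word starts with \<open>True\<close> and ends with \<open>False\<close>.
  Negated reversal preserves this pair of boundary letters and acts only on what lies between; the
  letter \<open>False\<close> is split off because \<open>last_weight\<close> accounts for
  it.\<close>

lemma index_word_admissible:
  assumes "admissible ks"
  obtains v where "index_word (rev ks) = False # v"
    "index_word (rev (dual_index ks)) = False # rev (map Not v)" "dual_index ks \<noteq> []"
proof -
  define v where "v = tl (index_word (rev ks))"
  have ne: "ks \<noteq> []" and last: "2 \<le> last ks" using assms by (auto simp: admissible_def)
  then obtain ks' k where ks: "ks = ks' @ [k]" by (metis append_butlast_last_id)
  obtain j where "k = Suc (Suc j)" using last ks by (cases k; cases "k - 1") auto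
  then have v: "index_word (rev ks) = False # v"
    using ks by (cases "rev ks'") (auto simp: v_def)
  have fw: "full_word ks = True # rev v @ [False]"
    using index_word_rev[OF ne] v by (metis append_Cons rev.simps(2) rev_append rev_rev_ident rev_singleton_conv)
  then have dual: "full_word (dual_index ks) = True # map Not v @ [False]"
    by (simp add: full_word_dual[OF assms] rev_map)
  then have ne': "dual_index ks \<noteq> []" by auto
  have "index_word (rev (dual_index ks)) @ [True] = (False # rev (map Not v)) @ [True]"
    using index_word_rev[OF ne'] dual by simp
  then show ?thesis using that v ne' by blast
qed

lemma head_coeff_replicate_False:
  "head_coeff \<alpha> (replicate j False @ v) l m = head_coeff \<alpha> v l m / (of_nat m + \<alpha>) ^ j"
  by (induction j) (auto simp: field_simps)

section \<open>Sums over tuples\<close>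

text \<open>The last exponent enters in full, unlike in \<open>Z_term\<close>, so that all entries
  are treated alike in the induction.\<close>

definition index_term :: "'a::real_normed_field \<Rightarrow> nat list \<Rightarrow> nat list \<Rightarrow> 'a" where
  "index_term \<alpha> ks ms = pochhammer \<alpha> (hd ms) / fact (hd ms) /
     (\<Prod>i<length ks. (of_nat (ms ! i) + \<alpha>) ^ (ks ! i))"

definition tuples_to :: "nat \<Rightarrow> nat \<Rightarrow> nat list set" where
  "tuples_to n m = {ms \<in> incr_tuples n. last ms = m}"

lemma index_term_nonneg: "0 < \<alpha> \<Longrightarrow> 0 \<le> index_term \<alpha> ks ms" for \<alpha> :: real
  unfolding index_term_def
  by (intro divide_nonneg_nonneg prod_nonneg pochhammer_nonneg) auto

lemma norm_index_term_le:
  assumes "0 < Re \<alpha>"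
  obtains K where "0 < K" "\<And>ks ms. norm (index_term \<alpha> ks ms) \<le> K * index_term (Re \<alpha>) ks ms"
proof -
  obtain K where K: "0 < K" "\<And>n. norm (pochhammer \<alpha> n) \<le> K * pochhammer (Re \<alpha>) n"
    using norm_pochhammer_le[OF assms] by blast
  have "norm (index_term \<alpha> ks ms) \<le> K * pochhammer (Re \<alpha>) (hd ms) / fact (hd ms) /
     (\<Prod>i<length ks. (of_nat (ms ! i) + Re \<alpha>) ^ (ks ! i))" for ks ms
    unfolding index_term_def norm_divide norm_fact prod_norm[symmetric] norm_power
    using K assms Re_add_of_nat_le_norm
    by (intro frac_le prod_mono prod_pos divide_right_mono)
       (auto intro!: mult_nonneg_nonneg divide_nonneg_nonneg power_mono zero_less_power pochhammer_nonneg)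
  with K(1) show ?thesis by (intro that[of K]) (auto simp: index_term_def)
qed

lemma index_term_snoc:
  assumes "length ms = length ks" "ks \<noteq> []"
  shows "index_term \<alpha> (ks @ [k]) (ms @ [m]) = index_term \<alpha> ks ms / (of_nat m + \<alpha>) ^ k"
proof -
  have "ms \<noteq> []" using assms by auto
  moreover have "(\<Prod>i<length ks. (of_nat ((ms @ [m]) ! i) + \<alpha>) ^ ((ks @ [k]) ! i)) =
      (\<Prod>i<length ks. (of_nat (ms ! i) + \<alpha>) ^ (ks ! i))"
    using assms by (intro prod.cong) (auto simp: nth_append)
  moreover have "(ms @ [m]) ! length ks = m" using assms(1) by (metis nth_append_length)
  ultimately show ?thesis by (simp add: index_term_def)
qed

text \<open>The last factor of \<open>pochhammer \<alpha> (last ms + 1)\<close> raises the exponent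
  k - 1 of the last entry to k; the bound on \<open>last ks\<close> keeps the natural subtraction
  exact.\<close>

lemma Z_term_eq_index_term:
  assumes "ks \<noteq> []" "length ms = length ks" "1 \<le> last ks"
  shows "Z_term ks \<alpha> \<alpha> ms = index_term \<alpha> ks ms * (fact (last ms) / pochhammer \<alpha> (last ms))"
proof -
  obtain ks' k where ks: "ks = ks' @ [k]" using assms by (metis append_butlast_last_id)
  obtain ms' m where ms: "ms = ms' @ [m]" using assms by (metis append_butlast_last_id length_0_conv)
  obtain j where j: "k = Suc j" using assms(3) ks by (cases k) auto
  have len: "length ms' = length ks'" using assms ks ms by simp
  define Q where "Q = (\<Prod>i<length ks'. (of_nat (ms ! i) + \<alpha>) ^ (ks ! i))"
  have "ms ! length ks' = m" unfolding ms using len by (metis nth_append_length)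
  moreover have "ks ! length ks' = k" by (simp add: ks)
  ultimately have "index_term \<alpha> ks ms = pochhammer \<alpha> (hd ms) / fact (hd ms) / (Q * (of_nat m + \<alpha>) ^ Suc j)"
    by (simp add: index_term_def Q_def j) (simp add: ks j)
  moreover have "Z_term ks \<alpha> \<alpha> ms = pochhammer \<alpha> (hd ms) / fact (hd ms) *
      (fact m / (pochhammer \<alpha> m * (of_nat m + \<alpha>))) / (Q * (of_nat m + \<alpha>) ^ j)"
  proof -
    have "length ks - 1 = length ks'" "last ks - 1 = j" "last ms = m" by (simp_all add: ks ms j)
    then show ?thesis
      by (simp only: Z_term_def Q_def Suc_eq_plus1[symmetric] pochhammer_Suc add.commute[of \<alpha>])
  qed
  moreover have "last ms = m" by (simp add: ms)
  ultimately show ?thesis by (simp add: mult_ac)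
qed

lemma finite_compositions: "finite (compositions n l)"
proof (rule finite_subset)
  show "compositions n l \<subseteq> {xs. set xs \<subseteq> {..l} \<and> length xs = n}"
    by (auto simp: compositions_def member_le_sum_list)
  show "finite {xs. set xs \<subseteq> {..l} \<and> length xs = n}" by (rule finite_lists_length_eq) simp
qed

lemma sum_compositions_Suc:
  "(\<Sum>ls\<in>compositions (Suc n) l. f ls) = (\<Sum>j\<le>l. \<Sum>ls\<in>compositions n (l - j). f (ls @ [j]))"
proof -
  have "(\<Sum>j\<le>l. \<Sum>ls\<in>compositions n (l - j). f (ls @ [j])) =
      (\<Sum>(j, ls)\<in>(SIGMA j:{..l}. compositions n (l - j)). f (ls @ [j]))"
    by (rule sum.Sigma) (auto simp: finite_compositions)
  also have "\<dots> = (\<Sum>ls\<in>compositions (Suc n) l. f ls)"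
  proof (rule sum.reindex_bij_witness[where i = "\<lambda>ls. (last ls, butlast ls)" and j = "\<lambda>(j, ls). ls @ [j]"])
    fix ls assume "ls \<in> compositions (Suc n) l"
    then have ls: "length ls = Suc n" "sum_list ls = l" by (auto simp: compositions_def)
    then have split: "butlast ls @ [last ls] = ls" by (intro append_butlast_last_id) auto
    then have "sum_list (butlast ls) + last ls = l" using ls by (metis sum_list_append sum_list.Cons sum_list.Nil add_0_right)
    then show "(last ls, butlast ls) \<in> (SIGMA j:{..l}. compositions n (l - j))"
      using ls by (auto simp: compositions_def)
    show "(case (last ls, butlast ls) of (j, ls) \<Rightarrow> ls @ [j]) = ls" using split by simp
  qed (auto simp: compositions_def)
  finally show ?thesis ..
qed

lemma incr_tuples_last_ge:
  assumes "ms \<in> incr_tuples n" "x \<in> set ms"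
  shows "x \<le> last ms"
proof -
  have "ms = butlast ms @ [last ms]" using assms(2) by (cases ms rule: rev_cases) auto
  moreover have "sorted_wrt (<) ms" using assms by (simp add: incr_tuples_def)
  ultimately have "\<forall>y\<in>set (butlast ms). y < last ms" by (metis sorted_wrt_append list.set_intros(1))
  then show ?thesis
    using assms(2) \<open>ms = butlast ms @ [last ms]\<close>
    by (metis Un_iff empty_iff empty_set less_imp_le order_refl set_ConsD set_append)
qed

lemma finite_tuples_to: "finite (tuples_to n m)"
proof (rule finite_subset)
  show "tuples_to n m \<subseteq> {xs. set xs \<subseteq> {..m} \<and> length xs = n}"
    using incr_tuples_last_ge by (force simp: tuples_to_def incr_tuples_def)
  show "finite {xs. set xs \<subseteq> {..m} \<and> length xs = n}" by (rule finite_lists_length_eq) simp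
qed

lemma tuples_to_1: "tuples_to (Suc 0) m = {[m]}"
  by (auto simp: tuples_to_def incr_tuples_def length_Suc_conv)

lemma sum_tuples_to_Suc:
  assumes "n \<noteq> 0"
  shows "(\<Sum>ms\<in>tuples_to (Suc n) m. f ms) = (\<Sum>k<m. \<Sum>ms\<in>tuples_to n k. f (ms @ [m]))"
proof -
  have "(\<Sum>k<m. \<Sum>ms\<in>tuples_to n k. f (ms @ [m])) =
      (\<Sum>(k, ms)\<in>(SIGMA k:{..<m}. tuples_to n k). f (ms @ [m]))"
    by (rule sum.Sigma) (auto simp: finite_tuples_to)
  also have "\<dots> = (\<Sum>ms\<in>tuples_to (Suc n) m. f ms)"
  proof (rule sum.reindex_bij_witness[where i = "\<lambda>ms. (last (butlast ms), butlast ms)" and j = "\<lambda>(k, ms). ms @ [m]"])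
    fix ms assume "ms \<in> tuples_to (Suc n) m"
    then obtain ms' where ms: "ms = ms' @ [m]" "length ms' = n" "sorted_wrt (<) (ms' @ [m])"
      by (cases ms rule: rev_cases) (auto simp: tuples_to_def incr_tuples_def)
    then have "last ms' \<in> set ms'" using assms by (intro last_in_set) auto
    then show "(last (butlast ms), butlast ms) \<in> (SIGMA k:{..<m}. tuples_to n k)"
      using ms by (auto simp: tuples_to_def incr_tuples_def sorted_wrt_append)
    show "(case (last (butlast ms), butlast ms) of (k, ms) \<Rightarrow> ms @ [m]) = ms" using ms by simp
  next
    fix p assume "p \<in> (SIGMA k:{..<m}. tuples_to n k)"
    then show "(case p of (k, ms) \<Rightarrow> ms @ [m]) \<in> tuples_to (Suc n) m"
      using incr_tuples_last_ge by (fastforce simp: tuples_to_def incr_tuples_def sorted_wrt_append)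
  qed (auto simp: tuples_to_def)
  finally show ?thesis ..
qed

text \<open>Induction from the right. A new last entry k + i contributes the power k - 1 through its
  letters \<open>False\<close> and the power i + 1 through \<open>True\<close>; the sum over i is
  the convolution in \<open>head_coeff\<close>.\<close>

lemma sum_index_term_eq_head_coeff:
  assumes "ks \<noteq> []" "\<forall>k\<in>set ks. 1 \<le> k"
  shows "(\<Sum>ls\<in>compositions (length ks) l. \<Sum>ms\<in>tuples_to (length ks) m. index_term \<alpha> (map2 (+) ks ls) ms) =
    head_coeff \<alpha> (index_word (rev ks)) l m"
  using assms
proof (induction ks arbitrary: l m rule: rev_nonempty_induct)
  case (single k)
  then obtain j where k: "k = Suc j" by (cases k) auto
  have c: "compositions (Suc 0) l = {[l]}" by (auto simp: compositions_def length_Suc_conv)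
  show ?case
    using head_coeff_replicate_False[of \<alpha> j "[]" l m]
    by (simp add: c k tuples_to_1 index_term_def power_add mult_ac)
next
  case (snoc k ks)
  obtain j where k: "k = Suc j" using snoc.prems by (cases k) auto
  obtain k' ks' where r: "rev ks = k' # ks'" using snoc by (cases "rev ks") auto
  let ?n = "length ks"
  have "?n \<noteq> 0" using snoc by simp
  have "(\<Sum>ls\<in>compositions (length (ks @ [k])) l. \<Sum>ms\<in>tuples_to (length (ks @ [k])) m.
      index_term \<alpha> (map2 (+) (ks @ [k]) ls) ms) =
    (\<Sum>i\<le>l. \<Sum>ls\<in>compositions ?n (l - i). \<Sum>q<m. \<Sum>ms\<in>tuples_to ?n q.
      index_term \<alpha> (map2 (+) (ks @ [k]) (ls @ [i])) (ms @ [m]))"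
    using \<open>?n \<noteq> 0\<close> by (simp add: sum_compositions_Suc sum_tuples_to_Suc)
  also have "\<dots> = (\<Sum>i\<le>l. \<Sum>ls\<in>compositions ?n (l - i). \<Sum>q<m. \<Sum>ms\<in>tuples_to ?n q.
      index_term \<alpha> (map2 (+) ks ls) ms / (of_nat m + \<alpha>) ^ (k + i))"
    using snoc.hyps
    by (intro sum.cong refl, subst index_term_snoc[symmetric])
       (auto simp: compositions_def tuples_to_def incr_tuples_def)
  also have "\<dots> = (\<Sum>i\<le>l. (\<Sum>q<m. \<Sum>ls\<in>compositions ?n (l - i). \<Sum>ms\<in>tuples_to ?n q.
      index_term \<alpha> (map2 (+) ks ls) ms) / (of_nat m + \<alpha>) ^ (k + i))"
    by (subst sum.swap) (simp add: sum_divide_distrib)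
  also have "\<dots> = (\<Sum>i\<le>l. (\<Sum>q<m. head_coeff \<alpha> (index_word (rev ks)) (l - i) q) / (of_nat m + \<alpha>) ^ Suc i) /
      (of_nat m + \<alpha>) ^ j"
    using snoc by (simp add: k sum_divide_distrib power_add mult_ac)
  also have "\<dots> = head_coeff \<alpha> (index_word (rev (ks @ [k]))) l m"
    by (simp add: r k head_coeff_replicate_False)
  finally show ?case .
qed

lemma map2_add_index:
  fixes ks ls :: "nat list"
  assumes "ks \<noteq> []" "\<forall>k\<in>set ks. 1 \<le> k" "length ls = length ks"
  shows "map2 (+) ks ls \<noteq> []" "1 \<le> last (map2 (+) ks ls)"
proof -
  show ne: "map2 (+) ks ls \<noteq> []" using assms by (auto simp: zip_eq_Nil_iff)
  have "last (map2 (+) ks ls) \<in> set (map2 (+) ks ls)" by (rule last_in_set[OF ne])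
  then show "1 \<le> last (map2 (+) ks ls)"
    using assms(2) by (auto dest!: set_zip_leftD intro: trans_le_add1)
qed

lemma incr_tuples_eq: "incr_tuples n = snd ` (SIGMA m:UNIV. tuples_to n m)"
  by (force simp: tuples_to_def)

section \<open>The sums of Z-values as coefficients\<close>

text \<open>The unordered sum Z is grouped by its last variable m. At the real part of \<alpha> all
  compositions contribute nonnegative terms, so the one given by \<open>ls\<close> is dominated by
  the full \<open>head_coeff\<close>; this yields absolute convergence.\<close>

lemma Z_sums:
  assumes "0 < Re \<alpha>" and ks: "ks \<noteq> []" "\<forall>k\<in>set ks. 1 \<le> k" "length ls = length ks"
    and word: "index_word (rev ks) = False # v"
  shows "(\<lambda>m. \<Sum>ms\<in>tuples_to (length ks) m.
      index_term \<alpha> (map2 (+) ks ls) ms * (fact m / pochhammer \<alpha> m)) sums Z (map2 (+) ks ls) \<alpha>"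
proof -
  let ?ks = "map2 (+) ks ls" and ?n = "length ks"
  let ?S = "SIGMA m:UNIV. tuples_to ?n m"
  define f where "f = (\<lambda>(m, ms). index_term \<alpha> ?ks ms * (fact m / pochhammer \<alpha> m))"
  define g where "g = (\<lambda>(m, ms). index_term (Re \<alpha>) ?ks ms * (fact m / pochhammer (Re \<alpha>) m))"
  have c: "0 \<le> fact m / pochhammer (Re \<alpha>) m" for m
    using assms(1) by (intro divide_nonneg_nonneg pochhammer_nonneg) auto
  have last_weight: "head_coeff (Re \<alpha>) (False # v) l m * (fact m / pochhammer (Re \<alpha>) m) =
      head_coeff (Re \<alpha>) v l m * last_weight (Re \<alpha>) m" for l m
    by (simp add: last_weight_def pochhammer_Suc add.commute mult.commute)
  have "g summable_on ?S"
  proof (rule summable_on_SigmaI)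
    show "((\<lambda>ms. g (m, ms)) has_sum (\<Sum>ms\<in>tuples_to ?n m. g (m, ms))) (tuples_to ?n m)" for m
      by (intro has_sum_finite finite_tuples_to)
    show nn: "0 \<le> g (m, ms)" for m ms
      unfolding g_def prod.case by (intro mult_nonneg_nonneg index_term_nonneg assms(1) c)
    show "(\<lambda>m. \<Sum>ms\<in>tuples_to ?n m. g (m, ms)) summable_on UNIV"
    proof (rule summable_on_comparison_test[OF head_coeff_last_weight_summable_real[OF assms(1), of v "sum_list ls"]])
      fix m
      have "(\<Sum>ms\<in>tuples_to ?n m. index_term (Re \<alpha>) ?ks ms) \<le>
        (\<Sum>ls\<in>compositions ?n (sum_list ls). \<Sum>ms\<in>tuples_to ?n m. index_term (Re \<alpha>) (map2 (+) ks ls) ms)"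
        by (rule member_le_sum[of ls _ "\<lambda>ls. \<Sum>ms\<in>tuples_to ?n m. index_term (Re \<alpha>) (map2 (+) ks ls) ms"])
           (use assms in \<open>auto simp: compositions_def finite_compositions[unfolded compositions_def]
              intro!: sum_nonneg index_term_nonneg\<close>)
      also have "\<dots> = head_coeff (Re \<alpha>) (False # v) (sum_list ls) m"
        using sum_index_term_eq_head_coeff[OF ks(1,2)] word by simp
      finally have "(\<Sum>ms\<in>tuples_to ?n m. index_term (Re \<alpha>) ?ks ms) * (fact m / pochhammer (Re \<alpha>) m) \<le>
          head_coeff (Re \<alpha>) (False # v) (sum_list ls) m * (fact m / pochhammer (Re \<alpha>) m)"
        using c by (rule mult_right_mono)
      then show "(\<Sum>ms\<in>tuples_to ?n m. g (m, ms)) \<le> head_coeff (Re \<alpha>) v (sum_list ls) m * last_weight (Re \<alpha>) m"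
        unfolding last_weight by (simp only: g_def prod.case sum_distrib_right)
      show "0 \<le> (\<Sum>ms\<in>tuples_to ?n m. g (m, ms))" by (intro sum_nonneg nn)
    qed
  qed
  obtain K where K: "0 < K" "\<And>ks ms. norm (index_term \<alpha> ks ms) \<le> K * index_term (Re \<alpha>) ks ms"
    using norm_index_term_le[OF assms(1)] by blast
  have "f summable_on ?S"
  proof (rule abs_summable_summable, rule Infinite_Sum.abs_summable_on_comparison_test')
    show "(\<lambda>p. K * g p) summable_on ?S" by (rule summable_on_cmult_right) fact
    fix p :: "nat \<times> nat list"
    obtain m ms where p: "p = (m, ms)" by (cases p)
    have "norm (fact m / pochhammer \<alpha> m) \<le> fact m / pochhammer (Re \<alpha>) m"
      unfolding norm_divide norm_fact
      using assms(1) by (intro divide_left_mono pochhammer_Re_le_norm mult_pos_pos pochhammer_pos)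
        (auto simp: pochhammer_nonzero nonpos_Ints_Re)
    then have "norm (index_term \<alpha> ?ks ms) * norm (fact m / pochhammer \<alpha> m) \<le>
        (K * index_term (Re \<alpha>) ?ks ms) * (fact m / pochhammer (Re \<alpha>) m)"
      using K(1) assms(1) by (intro mult_mono K(2)) (auto intro!: mult_nonneg_nonneg index_term_nonneg)
    then show "norm (f p) \<le> K * g p" by (simp only: p f_def g_def prod.case norm_mult mult.assoc)
  qed
  then have f: "(f has_sum infsum f ?S) ?S" by simp
  have inj: "inj_on snd ?S" by (auto simp: inj_on_def tuples_to_def)
  have "Z ?ks \<alpha> = infsum (Z_term ?ks \<alpha> \<alpha>) (snd ` ?S)"
    using ks(3) by (simp add: Z_def Z2_def incr_tuples_eq)
  also have "\<dots> = infsum (Z_term ?ks \<alpha> \<alpha> \<circ> snd) ?S" by (rule infsum_reindex[OF inj])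
  also have "\<dots> = infsum f ?S"
  proof (rule infsum_cong)
    fix p assume "p \<in> ?S"
    then show "(Z_term ?ks \<alpha> \<alpha> \<circ> snd) p = f p"
      using Z_term_eq_index_term[of ?ks "snd p" \<alpha>] map2_add_index[OF ks] ks(3)
      by (auto simp: f_def tuples_to_def incr_tuples_def)
  qed
  finally have Z: "Z ?ks \<alpha> = infsum f ?S" .
  have "((\<lambda>m. \<Sum>ms\<in>tuples_to ?n m. f (m, ms)) has_sum infsum f ?S) UNIV"
    using f by (rule has_sum_SigmaD) (intro has_sum_finite finite_tuples_to)
  then show ?thesis unfolding Z by (intro has_sum_imp_sums) (simp add: f_def)
qed

text \<open>Summing over compositions gives \<open>head_coeff\<close> of \<open>False # v\<close>;
  the leading \<open>False\<close> completes \<open>fact m / pochhammer \<alpha> m\<close> to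
  \<open>last_weight\<close>.\<close>

lemma sum_Z_sums:
  assumes "0 < Re \<alpha>" and ks: "ks \<noteq> []" "\<forall>k\<in>set ks. 1 \<le> k"
    and word: "index_word (rev ks) = False # v"
  shows "(\<lambda>m. head_coeff \<alpha> v l m * last_weight \<alpha> m) sums
    (\<Sum>ls\<in>compositions (length ks) l. Z (map2 (+) ks ls) \<alpha>)"
proof -
  have "(\<lambda>m. \<Sum>ls\<in>compositions (length ks) l. \<Sum>ms\<in>tuples_to (length ks) m.
      index_term \<alpha> (map2 (+) ks ls) ms * (fact m / pochhammer \<alpha> m)) sums
    (\<Sum>ls\<in>compositions (length ks) l. Z (map2 (+) ks ls) \<alpha>)"
    by (rule sums_sum, rule Z_sums[OF assms(1) ks _ word]) (simp add: compositions_def)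
  moreover have "(\<Sum>ls\<in>compositions (length ks) l. \<Sum>ms\<in>tuples_to (length ks) m.
      index_term \<alpha> (map2 (+) ks ls) ms * (fact m / pochhammer \<alpha> m)) = head_coeff \<alpha> v l m * last_weight \<alpha> m" for m
  proof -
    have "head_coeff \<alpha> (False # v) l m * (fact m / pochhammer \<alpha> m) = head_coeff \<alpha> v l m * last_weight \<alpha> m"
      by (simp add: last_weight_def pochhammer_Suc add.commute mult.commute)
    then show ?thesis
      using sum_index_term_eq_head_coeff[OF ks, where l = l and m = m and \<alpha> = \<alpha>] word by (simp only: sum_distrib_right[symmetric])
  qed
  ultimately show ?thesis by simp
qed

theorem theorem1p1:
  fixes ks :: "nat list" and l :: nat and \<alpha> :: complex
  assumes "admissible ks" and "0 < Re \<alpha>"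
  shows "(\<Sum>ls\<in>compositions (length ks) l. Z (map2 (+) ks ls) \<alpha>) =
         (\<Sum>ls\<in>compositions (length (dual_index ks)) l. Z (map2 (+) (dual_index ks) ls) \<alpha>)"
proof -
  obtain v where v: "index_word (rev ks) = False # v"
    "index_word (rev (dual_index ks)) = False # rev (map Not v)" "dual_index ks \<noteq> []"
    using index_word_admissible[OF assms(1)] by blast
  have ks: "ks \<noteq> []" "\<forall>k\<in>set ks. 1 \<le> k" using assms(1) by (auto simp: admissible_def)
  define A where "A l = (\<Sum>ls\<in>compositions (length ks) l. Z (map2 (+) ks ls) \<alpha>)" for l
  define B where "B l = (\<Sum>ls\<in>compositions (length (dual_index ks)) l. Z (map2 (+) (dual_index ks) ls) \<alpha>)" for l
  have A: "(\<lambda>m. head_coeff \<alpha> v l m * last_weight \<alpha> m) sums A l" for l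
    unfolding A_def by (rule sum_Z_sums[OF assms(2) ks v(1)])
  have B: "(\<lambda>m. head_coeff \<alpha> (rev (map Not v)) l m * last_weight \<alpha> m) sums B l" for l
    unfolding B_def using dual_index_pos by (intro sum_Z_sums assms(2) v) blast
  have "A l - B l = 0"
  proof (rule powser_coeffs_zero[OF assms(2), of "\<lambda>l. A l - B l"])
    \<comment> \<open>This range keeps the real part of \<alpha> - x positive; there both generating
      functions are connected sums divided by the same \<open>gauss_const\<close>.\<close>
    fix x assume x: "0 < x" "x < Re \<alpha>"
    have "connected_sum \<alpha> (\<alpha> - of_real x) v [] = connected_sum \<alpha> (\<alpha> - of_real x) (rev (map Not v)) []"
      using x assms(2) by (intro connected_sum_dual) auto
    then have "(\<lambda>l. A l * of_real x ^ l - B l * of_real x ^ l) sums 0"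
      using sums_diff[OF head_coeff_last_weight_generating_function[OF x A] head_coeff_last_weight_generating_function[OF x B]]
      by simp
    then show "(\<lambda>l. (A l - B l) * of_real x ^ l) sums 0" by (simp add: left_diff_distrib)
  qed
  then show ?thesis by (simp add: A_def B_def)
qed

end
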